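(* Let $n,d$ be integers with $2 \leq d \leq n-1$. Among all trees of order $n$ with diameter $d$, the minimum of the best meeting time $T_{\mathrm{bestmeet}}(G)$ is attained by the balanced lever $L_{n,d}$, and by no other tree (up to isomorphism). Moreover, $$ T_{\mathrm{bestmeet}}(L_{n,d}) = \begin{cases} \frac{d^3-d}{6(n-1)} + \frac{1}{2} & \text{if $d$ is odd,} \\ \frac{d^3-4d}{6(n-1)} + \frac{1}{2} & \text{if $d$ is even}. \\ \end{cases} $$
   Context: For a connected graph $G=(V,E)$, the simple random walk moves from a vertex $u$ to a uniformly random neighbor of $u$ at each step. The hitting time $H(u,v)$ is the expected number of steps for the walk started at $u$ to reach $v$, with $H(u,u)=0$. The stationary distribution is $\pi_v = \deg(v)/2|E|$. The meeting time at $v$ is $H(\pi,v)=\sum_{u\in V}\pi_u H(u,v)$, and the best meeting time of $G$ is $T_{\mathrm{bestmeet}}(G)=\min_{v\in V} H(\pi,v)$. A lever of order $n$ and diameter $d$ is a tree consisting of a path $v_0,v_1,\ldots,v_d$ together with $n-d-1$ additional leaves all adjacent to a single vertex $v_k$ of the path (the fulcrum), where $k$ is such that the resulting tree has diameter $d$. The balanced lever $L_{n,d}$ is the lever whose fulcrum is $v_{\lfloor d/2 \rfloor}$. *)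

theory Defs
  imports "HOL-Probability.Probability" "Graph_Theory.Graph_Theory"
begin

text \<open>
  A finite simple graph is a \<^term>\<open>pair_graph\<close>, i.e. a finite loop-free symmetric digraph in which
  each undirected edge is the pair of arcs \<open>(u, v)\<close> and \<open>(v, u)\<close>.
\<close>

definition edges :: "'a pair_pre_digraph \<Rightarrow> 'a set set" where
  "edges G = {{u, v} | u v. (u, v) \<in> parcs G}"

definition neighbors :: "'a pair_pre_digraph \<Rightarrow> 'a \<Rightarrow> 'a set" where
  "neighbors G u = {v. (u, v) \<in> parcs G}"

definition vertex_degree :: "'a pair_pre_digraph \<Rightarrow> 'a \<Rightarrow> nat" where
  "vertex_degree G u = card (neighbors G u)"

text \<open>
  In a symmetric digraph the arcs \<open>(u, v), (v, u)\<close> already form a \<open>cycle\<close> of length 2, so the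
  library's \<open>tree\<close> does not describe undirected trees. The cycles of the undirected graph are
  those of length at least 3.
\<close>

definition undirected_tree :: "'a pair_pre_digraph \<Rightarrow> bool" where
  "undirected_tree G \<longleftrightarrow>
     pair_graph G \<and> Digraph_Component.connected (with_proj G) \<and>
     \<not> (\<exists>p. pre_digraph.cycle (with_proj G) p \<and> 3 \<le> length p)"

text \<open>With unit weights \<open>wf_digraph.\<mu>\<close> is the graph distance.\<close>

definition graph_diameter :: "'a pair_pre_digraph \<Rightarrow> ereal" where
  "graph_diameter G =
     (SUP u \<in> pverts G. SUP v \<in> pverts G. wf_digraph.\<mu> (with_proj G) (\<lambda>_. 1) u v)"

text \<open>
  The law of the trajectory \<open>\<omega> 0, \<omega> 1, \<dots>\<close> of the simple random walk started at \<open>u\<close> is the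
  Ionescu-Tulcea measure whose \<open>i\<close>-th kernel gives the law of \<open>\<omega> i\<close> conditioned on
  \<open>\<omega> 0, \<dots>, \<omega> (i - 1)\<close>.
\<close>

fun srw_kernel :: "'a pair_pre_digraph \<Rightarrow> 'a \<Rightarrow> nat \<Rightarrow> (nat \<Rightarrow> 'a) \<Rightarrow> 'a measure" where
  "srw_kernel G u 0 \<omega> = measure_pmf (return_pmf u)"
| "srw_kernel G u (Suc i) \<omega> = measure_pmf (pmf_of_set (neighbors G (\<omega> i)))"

lemma Ionescu_Tulcea_srw: "Ionescu_Tulcea (srw_kernel G u) (\<lambda>_. count_space UNIV)"
proof (rule Ionescu_Tulcea.intro)
  fix i :: nat
  show "srw_kernel G u i
    \<in> Pi\<^sub>M {0..<i} (\<lambda>_. count_space UNIV) \<rightarrow>\<^sub>M subprob_algebra (count_space UNIV)"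
  proof (cases i)
    case 0
    have "srw_kernel G u i = (\<lambda>_. measure_pmf (return_pmf u))"
      by (simp add: 0 fun_eq_iff)
    then show ?thesis
      by (simp add: measure_pmf_in_subprob_algebra)
  next
    case (Suc j)
    have comp: "(\<lambda>\<omega>. \<omega> j) \<in> Pi\<^sub>M {0..<i} (\<lambda>_. count_space UNIV) \<rightarrow>\<^sub>M count_space (UNIV :: 'a set)"
      by (rule measurable_component_singleton) (simp add: Suc)
    have "(\<lambda>x. measure_pmf (pmf_of_set (neighbors G x)))
      \<in> count_space UNIV \<rightarrow>\<^sub>M subprob_algebra (count_space UNIV)"
      by (simp add: measure_pmf_in_subprob_algebra)
    from measurable_compose[OF comp this]
    have "(\<lambda>\<omega>. measure_pmf (pmf_of_set (neighbors G (\<omega> j))))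
      \<in> Pi\<^sub>M {0..<i} (\<lambda>_. count_space UNIV) \<rightarrow>\<^sub>M subprob_algebra (count_space UNIV)" .
    moreover have "srw_kernel G u i = (\<lambda>\<omega>. measure_pmf (pmf_of_set (neighbors G (\<omega> j))))"
      by (simp add: Suc fun_eq_iff)
    ultimately show ?thesis by simp
  qed
next
  show "prob_space (srw_kernel G u i \<omega>)" for i \<omega>
    by (cases i) (auto intro: prob_space_measure_pmf)
qed

definition srw :: "'a pair_pre_digraph \<Rightarrow> 'a \<Rightarrow> (nat \<Rightarrow> 'a) measure" where
  "srw G u =
     projective_family.lim UNIV
       (Ionescu_Tulcea.CI (srw_kernel G u) (\<lambda>_. count_space UNIV)) (\<lambda>_. count_space UNIV)"

definition first_hit :: "'a \<Rightarrow> (nat \<Rightarrow> 'a) \<Rightarrow> enat" where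
  "first_hit v \<omega> = (INF t \<in> {t. \<omega> t = v}. enat t)"

definition hitting_time :: "'a pair_pre_digraph \<Rightarrow> 'a \<Rightarrow> 'a \<Rightarrow> ennreal" where
  "hitting_time G u v = (\<integral>\<^sup>+ \<omega>. ennreal_of_enat (first_hit v \<omega>) \<partial>srw G u)"

definition stationary :: "'a pair_pre_digraph \<Rightarrow> 'a \<Rightarrow> real" where
  "stationary G v = real (vertex_degree G v) / (2 * real (card (edges G)))"

definition meeting_time :: "'a pair_pre_digraph \<Rightarrow> 'a \<Rightarrow> ennreal" where
  "meeting_time G v = (\<Sum>u\<in>pverts G. ennreal (stationary G u) * hitting_time G u v)"

definition best_meeting_time :: "'a pair_pre_digraph \<Rightarrow> ennreal" where
  "best_meeting_time G = Min (meeting_time G ` pverts G)"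

text \<open>
  \<open>lever n d k\<close> has the path \<open>0, 1, \<dots>, d\<close>, and the extra leaves \<open>d + 1, \<dots>, n - 1\<close>
  attached to the fulcrum \<open>k\<close>.
\<close>

definition lever :: "nat \<Rightarrow> nat \<Rightarrow> nat \<Rightarrow> nat pair_pre_digraph" where
  "lever n d k =
     (let A = {(i, i + 1) | i. i < d} \<union> {(k, j) | j. d < j \<and> j < n}
      in \<lparr>pverts = {..<n}, parcs = A \<union> A\<inverse>\<rparr>)"

definition balanced_lever :: "nat \<Rightarrow> nat \<Rightarrow> nat pair_pre_digraph" where
  "balanced_lever n d = lever n d (d div 2)"

end

theory Submission
  imports Defs
begin

text \<open>
  Root the tree at the target \<open>r\<close>. If \<open>s\<^sub>w\<close> is the size of the subtree below \<open>w \<noteq> r\<close>, the walk needs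
  \<open>2 s\<^sub>w - 1\<close> expected steps from \<open>w\<close> to its parent, which is also the sum of the degrees below \<open>w\<close>.
  Double counting gives \<open>H(\<pi>, r) = (\<Sum> (2 s\<^sub>w - 1)\<^sup>2) / (2 (n - 1))\<close>, that is
  \<open>1 / 2 + 4 (\<Sum> s\<^sub>w choose 2) / (n - 1)\<close>. The two ends of a diametral path climb towards \<open>r\<close> along
  disjoint trails of lengths \<open>k\<close> and \<open>l\<close> with \<open>k + l \<ge> d\<close>, and on each of them the subtree sizes are
  at least \<open>1, 2, 3, \<dots>\<close>, so that the sum is at least \<open>(k + 1 choose 3) + (l + 1 choose 3)\<close>. By strict
  convexity this is minimal exactly for the balanced split. In the case of equality all subtrees are
  as small as possible, which forces the trails to end in \<open>r\<close> and every other vertex to be a leaf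
  attached to \<open>r\<close>.
\<close>

section \<open>Binomial coefficients and discrete convexity\<close>

lemma real_choose_two: "real (n choose 2) = real n * (real n - 1) / 2"
  by (induction n) (auto simp: numeral_2_eq_2 field_simps)

lemma real_choose_three: "real (Suc k choose 3) = (real k ^ 3 - real k) / 6"
proof (induction k)
  case (Suc k)
  have "Suc (Suc k) choose 3 = (Suc k choose 3) + (Suc k choose 2)"
    by (simp add: numeral_3_eq_3 numeral_2_eq_2)
  then show ?case
    using Suc by (simp add: real_choose_two power3_eq_cube field_simps)
qed (simp add: numeral_3_eq_3)

lemma sum_Suc_choose_two: "(\<Sum>i<k. Suc i choose 2) = Suc k choose 3"
  by (induction k) (simp_all add: numeral_3_eq_3 numeral_2_eq_2)

lemma choose_two_less:
  assumes "0 < m" and "m < n"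
  shows "m choose 2 < n choose 2"
proof -
  have "m choose 2 < Suc m choose 2" using \<open>0 < m\<close> by (simp add: numeral_2_eq_2)
  also have "\<dots> \<le> n choose 2" using \<open>m < n\<close> by (intro binomial_right_mono) simp
  finally show ?thesis .
qed

lemma
  fixes f :: "nat \<Rightarrow> real"
  assumes convex: "strict_mono (\<lambda>i. f (Suc i) - f i)"
  shows strictly_convex_nat_tangent_le: "f m + (real k - real m) * (f (Suc m) - f m) \<le> f k"
    and strictly_convex_nat_tangent_less:
      "k \<noteq> m \<Longrightarrow> k \<noteq> Suc m \<Longrightarrow> f m + (real k - real m) * (f (Suc m) - f m) < f k"
proof -
  define \<Delta> where "\<Delta> i = f (Suc i) - f i" for i
  have less: "\<Delta> i < \<Delta> j" if "i < j" for i j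
    using convex that by (simp add: strict_mono_def \<Delta>_def)
  have telescope: "(\<Sum>i=a..<b. \<Delta> i - \<Delta> m) = f b - f a - (real b - real a) * \<Delta> m"
    if "a \<le> b" for a b
    using sum_Suc_diff'[OF that, of f, folded \<Delta>_def] that by (simp add: sum_subtractf of_nat_diff)
  have strict: "f m + (real k - real m) * \<Delta> m < f k" if "k \<noteq> m" "k \<noteq> Suc m"
  proof (cases "m < k")
    case True
    have "f k - f m - (real k - real m) * \<Delta> m = (\<Sum>i=m..<k. \<Delta> i - \<Delta> m)"
      using True by (simp add: telescope)
    also have "\<dots> > 0"
    proof (rule sum_pos2[of _ "Suc m"])
      show "Suc m \<in> {m..<k}" using True that by simp
      show "0 \<le> \<Delta> i - \<Delta> m" if "i \<in> {m..<k}" for i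
        using less[of m i] that by (cases "i = m") auto
    qed (use less in auto)
    finally show ?thesis by simp
  next
    case False
    then have "f m - f k - (real m - real k) * \<Delta> m = (\<Sum>i=k..<m. \<Delta> i - \<Delta> m)"
      by (simp add: telescope)
    also have "\<dots> < (\<Sum>i=k..<m. 0)"
      using False that less by (intro sum_strict_mono) auto
    finally show ?thesis by (simp add: algebra_simps)
  qed
  then show "k \<noteq> m \<Longrightarrow> k \<noteq> Suc m \<Longrightarrow> f m + (real k - real m) * (f (Suc m) - f m) < f k"
    by (simp add: \<Delta>_def)
  show "f m + (real k - real m) * (f (Suc m) - f m) \<le> f k"
    using strict by (cases "k = m \<or> k = Suc m") (auto simp: \<Delta>_def)
qed

lemma
  fixes f :: "nat \<Rightarrow> real"
  assumes convex: "strict_mono (\<lambda>i. f (Suc i) - f i)" and "d \<le> k + l"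
  defines "m \<equiv> d div 2"
  shows strictly_convex_nat_balanced_split_le:
      "f m \<le> f (Suc m) \<Longrightarrow> f m + f (d - m) \<le> f k + f l"
    and strictly_convex_nat_balanced_split_unique:
      "f m < f (Suc m) \<Longrightarrow> f k + f l = f m + f (d - m) \<Longrightarrow>
      k = m \<and> l = d - m \<or> k = d - m \<and> l = m"
proof -
  define s where "s = f (Suc m) - f m"
  have d: "d - m = m \<or> d - m = Suc m" "2 * m \<le> d" by (auto simp: m_def)
  have "f (d - m) = f m + (real (d - m) - real m) * s"
    using d(1) by (auto simp: s_def)
  then have balanced: "f m + f (d - m) = 2 * f m + (real d - 2 * real m) * s"
    using d(2) by (simp add: of_nat_diff)
  note tangent = strictly_convex_nat_tangent_le[OF convex, where m = m, folded s_def]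
    and tangent_strict = strictly_convex_nat_tangent_less[OF convex, where m = m, folded s_def]
  have split: "2 * f m + (real k + real l - 2 * real m) * s
      = (f m + (real k - real m) * s) + (f m + (real l - real m) * s)"
    by (simp add: algebra_simps)
  have slope: "(real d - 2 * real m) * s \<le> (real k + real l - 2 * real m) * s" if "0 \<le> s"
    using that \<open>d \<le> k + l\<close> by (intro mult_right_mono) auto
  show "f m + f (d - m) \<le> f k + f l" if "f m \<le> f (Suc m)"
    using slope balanced split tangent[of k] tangent[of l] that unfolding s_def by linarith
  assume "f m < f (Suc m)" and eq: "f k + f l = f m + f (d - m)"
  then have "0 < s" by (simp add: s_def)
  then have slope: "(real d - 2 * real m) * s \<le> (real k + real l - 2 * real m) * s"
    by (intro slope) simp
  have "k = m \<or> k = Suc m"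
    using eq slope balanced split tangent_strict[of k] tangent[of l] by linarith
  moreover have "l = m \<or> l = Suc m"
    using eq slope balanced split tangent[of k] tangent_strict[of l] by linarith
  moreover have "(real d - 2 * real m) * s = (real k + real l - 2 * real m) * s"
    using eq slope balanced split tangent[of k] tangent[of l] by linarith
  then have "d = k + l" using \<open>0 < s\<close> by simp
  ultimately show "k = m \<and> l = d - m \<or> k = d - m \<and> l = m"
    using d by auto
qed

section \<open>Hitting times of the random walk\<close>

definition avoiding :: "'a \<Rightarrow> nat \<Rightarrow> (nat \<Rightarrow> 'a) set" where
  "avoiding v t = {\<omega>. \<forall>i\<le>t. \<omega> i \<noteq> v}"

lemma indicator_avoiding_0:
  "indicator (avoiding v 0) \<omega> = (indicator (- {v}) (\<omega> 0) :: 'b :: zero_neq_one)"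
  by (simp add: avoiding_def indicator_def)

lemma avoiding_Int_space_PiM:
  "avoiding v t \<inter> space (PiM {0..<Suc t} (\<lambda>_. count_space UNIV)) = PiE {0..<Suc t} (\<lambda>_. - {v})"
  by (auto simp: avoiding_def space_PiM PiE_iff less_Suc_eq_le)

lemma avoiding_sets_PiM:
  "avoiding v t \<inter> space (PiM {0..<Suc t} (\<lambda>_. count_space UNIV))
    \<in> sets (PiM {0..<Suc t} (\<lambda>_. count_space UNIV))"
  by (auto simp: avoiding_Int_space_PiM intro!: sets_PiM_I_finite)

lemma borel_measurable_avoiding:
  fixes f :: "'a \<Rightarrow> ennreal"
  shows "(\<lambda>\<omega>. indicator (avoiding v t) \<omega> * f (\<omega> t))
    \<in> borel_measurable (PiM {0..<Suc t} (\<lambda>_. count_space UNIV))"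
proof (rule borel_measurable_times_ennreal)
  show "(indicator (avoiding v t) :: _ \<Rightarrow> ennreal)
      \<in> borel_measurable (PiM {0..<Suc t} (\<lambda>_. count_space UNIV))"
    by (simp only: borel_measurable_indicator_iff avoiding_sets_PiM)
  show "(\<lambda>\<omega>. f (\<omega> t)) \<in> borel_measurable (PiM {0..<Suc t} (\<lambda>_. count_space UNIV))"
    by (rule measurable_compose[OF measurable_component_singleton]) auto
qed

definition avoid_step :: "'a pair_pre_digraph \<Rightarrow> 'a \<Rightarrow> ('a \<Rightarrow> ennreal) \<Rightarrow> 'a \<Rightarrow> ennreal" where
  "avoid_step G v f x =
     (\<integral>\<^sup>+ y. indicator (- {v}) y * f y \<partial>measure_pmf (pmf_of_set (neighbors G x)))"

definition avoid_prob :: "'a pair_pre_digraph \<Rightarrow> 'a \<Rightarrow> nat \<Rightarrow> 'a \<Rightarrow> ennreal" where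
  "avoid_prob G v t u = indicator (- {v}) u * (avoid_step G v ^^ t) (\<lambda>_. 1) u"

lemma avoid_prob_target [simp]: "avoid_prob G v t v = 0"
  by (simp add: avoid_prob_def)

lemma avoid_prob_0: "u \<noteq> v \<Longrightarrow> avoid_prob G v 0 u = 1"
  by (simp add: avoid_prob_def)

lemma avoid_prob_Suc:
  assumes "u \<noteq> v" and "finite (neighbors G u)" and "neighbors G u \<noteq> {}"
  shows "avoid_prob G v (Suc t) u
    = (\<Sum>w\<in>neighbors G u. avoid_prob G v t w) / card (neighbors G u)"
  using assms by (simp add: avoid_prob_def avoid_step_def nn_integral_pmf_of_set)

context
  fixes G :: "'a pair_pre_digraph" and u v :: 'a
begin

interpretation W: Ionescu_Tulcea "srw_kernel G u" "\<lambda>_. count_space UNIV"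
  by (rule Ionescu_Tulcea_srw)

abbreviation trajectory_law :: "nat \<Rightarrow> (nat \<Rightarrow> 'a) measure" where
  "trajectory_law t \<equiv> W.C 0 (Suc t) (\<lambda>_. undefined)"

lemma space_trajectory_law: "space (trajectory_law t) = space (PiM {0..<Suc t} (\<lambda>_. count_space UNIV))"
  using W.space_C[of "\<lambda>_. undefined" 0 "Suc t"] by (simp add: space_PiM del: W.C.simps)

lemma sets_trajectory_law: "sets (trajectory_law t) = sets (PiM {0..<Suc t} (\<lambda>_. count_space UNIV))"
  using W.sets_C[of "\<lambda>_. undefined" 0 "Suc t"] by (simp add: space_PiM del: W.C.simps)

lemma trajectory_law_0: "trajectory_law 0 = W.eP 0 (\<lambda>_. undefined)"
  by (simp add: bind_return[OF W.measurable_eP[of 0, simplified]] space_PiM)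

lemma nn_integral_trajectory_law_Suc:
  assumes "f \<in> borel_measurable (PiM {0..<Suc (Suc t)} (\<lambda>_. count_space UNIV))"
  shows "(\<integral>\<^sup>+ \<omega>. f \<omega> \<partial>trajectory_law (Suc t))
    = (\<integral>\<^sup>+ \<omega>. (\<integral>\<^sup>+ \<omega>'. f \<omega>' \<partial>W.eP (Suc t) \<omega>) \<partial>trajectory_law t)"
  unfolding W.C.simps(2)[of 0 "Suc t"]
  by (subst nn_integral_bind[where B = "PiM {0..<Suc (Suc t)} (\<lambda>_. count_space UNIV)"])
     (use assms W.measurable_eP[of "Suc t"] in
       \<open>auto simp del: W.C.simps simp: measurable_cong_sets[OF sets_trajectory_law] space_PiM\<close>)

lemma nn_integral_eP_avoiding:
  assumes \<omega>: "\<omega> \<in> space (PiM {0..<Suc t} (\<lambda>_. count_space UNIV))"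
  shows "(\<integral>\<^sup>+ \<omega>'. indicator (avoiding v (Suc t)) \<omega>' * f (\<omega>' (Suc t)) \<partial>W.eP (Suc t) \<omega>)
    = indicator (avoiding v t) \<omega> * avoid_step G v f (\<omega> t)"
proof -
  have "(\<integral>\<^sup>+ \<omega>'. indicator (avoiding v (Suc t)) \<omega>' * f (\<omega>' (Suc t)) \<partial>W.eP (Suc t) \<omega>)
    = (\<integral>\<^sup>+ x. indicator (avoiding v t) \<omega> * (indicator (- {v}) x * f x) \<partial>srw_kernel G u (Suc t) \<omega>)"
    unfolding W.nn_integral_eP[OF \<omega> borel_measurable_avoiding]
    by (intro nn_integral_cong) (auto simp: avoiding_def indicator_def le_Suc_eq)
  then show ?thesis
    by (simp add: nn_integral_cmult avoid_step_def)
qed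

text \<open>
  The kernels extend a trajectory at its end. Iterating \<open>avoid_step\<close> turns this into a recursion in
  the starting vertex, so no Markov property of the infinite trajectory is needed.
\<close>

lemma nn_integral_avoiding:
  "(\<integral>\<^sup>+ \<omega>. indicator (avoiding v t) \<omega> * f (\<omega> t) \<partial>trajectory_law t)
    = indicator (- {v}) u * (avoid_step G v ^^ t) f u"
proof (induction t arbitrary: f)
  case 0
  show ?case
    unfolding trajectory_law_0
    by (subst W.nn_integral_eP)
       (use borel_measurable_avoiding[of v 0 f] in
         \<open>auto simp: space_PiM nn_integral_return indicator_avoiding_0\<close>)
next
  case (Suc t)
  have "(\<integral>\<^sup>+ \<omega>. indicator (avoiding v (Suc t)) \<omega> * f (\<omega> (Suc t)) \<partial>trajectory_law (Suc t))
    = (\<integral>\<^sup>+ \<omega>. indicator (avoiding v t) \<omega> * avoid_step G v f (\<omega> t) \<partial>trajectory_law t)"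
    unfolding nn_integral_trajectory_law_Suc[OF borel_measurable_avoiding]
    by (intro nn_integral_cong nn_integral_eP_avoiding) (simp add: space_trajectory_law del: W.C.simps)
  also have "\<dots> = indicator (- {v}) u * (avoid_step G v ^^ Suc t) f u"
    unfolding Suc.IH by (simp add: funpow_swap1)
  finally show ?case .
qed

lemma emeasure_srw_avoiding: "emeasure (srw G u) (avoiding v t) = avoid_prob G v t u"
proof -
  let ?M = "PiM {0..<Suc t} (\<lambda>_. count_space (UNIV :: 'a set))"
  define X where "X = avoiding v t \<inter> space ?M"
  have X: "X \<in> sets ?M"
    unfolding X_def by (rule avoiding_sets_PiM)
  have "avoiding v t = W.PF.emb UNIV {0..<Suc t} X"
    by (auto simp: prod_emb_def X_def avoiding_def space_PiM)
  then have "emeasure (srw G u) (avoiding v t) = W.CI {0..<Suc t} X"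
    unfolding srw_def using W.lim[OF _ X] by simp
  also have "\<dots> = trajectory_law t (W.PF.emb {0..<Suc t} {0..<Suc t} X)"
    by (rule W.emeasure_CI[OF _ X]) simp
  also have "W.PF.emb {0..<Suc t} {0..<Suc t} X = X"
    by (rule prod_emb_id) (auto simp: X_def space_PiM)
  also have "trajectory_law t X = (\<integral>\<^sup>+ \<omega>. indicator (avoiding v t) \<omega> * 1 \<partial>trajectory_law t)"
    unfolding X_def space_trajectory_law[symmetric]
    using X by (simp add: nn_integral_indicator' X_def space_trajectory_law sets_trajectory_law
        del: W.C.simps)
  also have "\<dots> = avoid_prob G v t u"
    using nn_integral_avoiding[of t "\<lambda>_. 1"] by (simp only: avoid_prob_def)
  finally show ?thesis .
qed

lemma sets_srw: "sets (srw G u) = sets (PiM UNIV (\<lambda>_. count_space UNIV))"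
  unfolding srw_def by (rule W.PF.sets_lim)

end

lemma less_first_hit_iff: "enat t < first_hit v \<omega> \<longleftrightarrow> \<omega> \<in> avoiding v t"
proof
  assume less: "enat t < first_hit v \<omega>"
  have "\<omega> i \<noteq> v" if "i \<le> t" for i
  proof
    assume "\<omega> i = v"
    then have "first_hit v \<omega> \<le> enat i"
      unfolding first_hit_def by (intro INF_lower) auto
    with less have "enat t < enat i" by (rule less_le_trans)
    then show False using that by simp
  qed
  then show "\<omega> \<in> avoiding v t" by (simp add: avoiding_def)
next
  assume "\<omega> \<in> avoiding v t"
  then have "enat (Suc t) \<le> first_hit v \<omega>"
    unfolding first_hit_def avoiding_def
    by (intro INF_greatest) (auto simp: not_less_eq_eq[symmetric])
  then show "enat t < first_hit v \<omega>"
    by (rule less_le_trans[rotated]) simp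
qed

lemma first_hit_eq_INF: "first_hit v \<omega> = (INF t. if \<omega> t = v then enat t else \<top>)"
proof (rule antisym)
  have "first_hit v \<omega> \<le> enat t" if "\<omega> t = v" for t
    unfolding first_hit_def using that by (intro INF_lower) simp
  then show "first_hit v \<omega> \<le> (INF t. if \<omega> t = v then enat t else \<top>)"
    by (intro INF_greatest) simp
  have "(INF t. if \<omega> t = v then enat t else \<top>) \<le> enat t" if "\<omega> t = v" for t
    using that by (intro INF_lower2[of t]) simp_all
  then show "(INF t. if \<omega> t = v then enat t else \<top>) \<le> first_hit v \<omega>"
    unfolding first_hit_def by (intro INF_greatest) simp
qed

lemma measurable_first_hit: "first_hit v \<in> measurable (srw G u) (count_space UNIV)"
proof -
  have "(\<lambda>\<omega>. INF t. if \<omega> t = v then enat t else \<top>)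
      \<in> measurable (PiM UNIV (\<lambda>_. count_space UNIV)) (count_space UNIV)"
    by measurable
  then show ?thesis
    by (simp add: measurable_cong_sets[OF sets_srw refl] first_hit_eq_INF[abs_def])
qed

lemma hitting_time_eq_suminf: "hitting_time G u v = (\<Sum>t. avoid_prob G v t u)"
proof -
  have "space (srw G u) = UNIV"
    using sets_eq_imp_space_eq[OF sets_srw[of G u]] by (simp add: space_PiM)
  then show ?thesis
    unfolding hitting_time_def nn_integral_enat_function[OF measurable_first_hit]
    by (simp add: less_first_hit_iff emeasure_srw_avoiding)
qed

lemma hitting_time_self: "hitting_time G v v = 0"
  by (simp add: hitting_time_eq_suminf)

lemma hitting_time_step:
  assumes "u \<noteq> v" and "finite (neighbors G u)" and "neighbors G u \<noteq> {}"
  shows "hitting_time G u v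
    = 1 + (\<Sum>w\<in>neighbors G u. hitting_time G w v) / card (neighbors G u)"
proof -
  have "hitting_time G u v = avoid_prob G v 0 u + (\<Sum>t. avoid_prob G v (Suc t) u)"
    using suminf_offset[of "\<lambda>t. avoid_prob G v t u" 1] by (simp add: hitting_time_eq_suminf)
  then show ?thesis
    using assms by (simp add: avoid_prob_0 avoid_prob_Suc suminf_sum hitting_time_eq_suminf)
qed

lemma hitting_time_le_supersolution:
  fixes g :: "'a \<Rightarrow> ennreal"
  assumes nb: "\<And>w. w \<in> S \<Longrightarrow> w \<noteq> v \<Longrightarrow>
      finite (neighbors G w) \<and> neighbors G w \<noteq> {} \<and> neighbors G w \<subseteq> S"
    and super: "\<And>w. w \<in> S \<Longrightarrow> w \<noteq> v \<Longrightarrow>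
      1 + (\<Sum>x\<in>neighbors G w. g x) / card (neighbors G w) \<le> g w"
    and "u \<in> S"
  shows "hitting_time G u v \<le> g u"
proof -
  have "(\<Sum>t<T. avoid_prob G v t w) \<le> g w" if "w \<in> S" for T w
    using that
  proof (induction T arbitrary: w)
    case (Suc T)
    show ?case
    proof (cases "w = v")
      case False
      let ?N = "neighbors G w"
      note N = nb[OF Suc.prems False]
      have "(\<Sum>t<Suc T. avoid_prob G v t w) = 1 + (\<Sum>t<T. (\<Sum>x\<in>?N. avoid_prob G v t x) / card ?N)"
        using False N
        by (simp add: sum.lessThan_Suc_shift avoid_prob_0 avoid_prob_Suc del: sum.lessThan_Suc)
      also have "\<dots> = 1 + (\<Sum>x\<in>?N. \<Sum>t<T. avoid_prob G v t x) / card ?N"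
        by (subst sum.swap) (simp add: divide_ennreal_def sum_distrib_right)
      also have "\<dots> \<le> 1 + (\<Sum>x\<in>?N. g x) / card ?N"
        using N by (intro add_left_mono divide_right_mono_ennreal sum_mono Suc.IH) auto
      also have "\<dots> \<le> g w" by (rule super[OF Suc.prems False])
      finally show ?thesis .
    qed simp
  qed simp
  then show ?thesis
    unfolding hitting_time_eq_suminf using \<open>u \<in> S\<close> by (intro suminf_le_const summableI)
qed

lemma hitting_time_step_real:
  fixes h :: "'a \<Rightarrow> real"
  assumes "u \<noteq> v" and N: "finite (neighbors G u)" "neighbors G u \<noteq> {}"
    and h: "\<And>w. w \<in> insert u (neighbors G u) \<Longrightarrow> hitting_time G w v = ennreal (h w)"
    and nonneg: "\<And>w. 0 \<le> h w"
  shows "(\<Sum>w\<in>neighbors G u. h w) = real (card (neighbors G u)) * (h u - 1)"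
proof -
  let ?N = "neighbors G u"
  have pos: "0 < real (card ?N)" using N by (simp add: card_gt_0_iff)
  have "ennreal (h u) = 1 + (\<Sum>w\<in>?N. hitting_time G w v) / card ?N"
    using hitting_time_step[OF \<open>u \<noteq> v\<close> N] h[of u] by simp
  also have "(\<Sum>w\<in>?N. hitting_time G w v) = ennreal (\<Sum>w\<in>?N. h w)"
    using h nonneg by (simp add: sum_ennreal)
  also have "1 + ennreal (\<Sum>w\<in>?N. h w) / card ?N = ennreal (1 + (\<Sum>w\<in>?N. h w) / card ?N)"
    using nonneg pos
    by (simp add: sum_nonneg divide_ennreal ennreal_of_nat_eq_real_of_nat flip: ennreal_1 ennreal_plus)
  finally have "h u = 1 + (\<Sum>w\<in>?N. h w) / card ?N"
    using nonneg by (simp add: add_nonneg_nonneg sum_nonneg del: ennreal_plus)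
  then show ?thesis using pos by (simp add: field_simps)
qed

section \<open>Distances and the diameter\<close>

lemma relpow_iff_pcas:
  "(u, v) \<in> R ^^ k \<longleftrightarrow> (\<exists>p. set p \<subseteq> R \<and> pcas u p v \<and> length p = k)"
proof (induction k arbitrary: u)
  case (Suc k)
  show ?case
  proof
    assume "(u, v) \<in> R ^^ Suc k"
    then obtain w where "(u, w) \<in> R" "(w, v) \<in> R ^^ k" by (blast dest: relpow_Suc_D2)
    then obtain p where "set p \<subseteq> R" "pcas w p v" "length p = k" using Suc.IH by blast
    with \<open>(u, w) \<in> R\<close> show "\<exists>p. set p \<subseteq> R \<and> pcas u p v \<and> length p = Suc k"
      by (intro exI[of _ "(u, w) # p"]) simp
  next
    assume "\<exists>p. set p \<subseteq> R \<and> pcas u p v \<and> length p = Suc k"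
    then obtain e p where "e \<in> R" "fst e = u" "set p \<subseteq> R" "pcas (snd e) p v" "length p = k"
      by (auto simp: length_Suc_conv)
    then show "(u, v) \<in> R ^^ Suc k"
      using Suc.IH by (intro relpow_Suc_I2[of u "snd e"]) auto
  qed
qed auto

lemma awalk_with_proj_iff:
  "pre_digraph.awalk (with_proj G) u p v \<longleftrightarrow> u \<in> pverts G \<and> set p \<subseteq> parcs G \<and> pcas u p v"
  by (simp add: pre_digraph.awalk_def cas_with_proj_eq)

lemma sym_relpow:
  assumes "sym R"
  shows "sym (R ^^ k)"
proof (induction k)
  case (Suc k)
  show ?case
  proof (rule symI)
    fix x y assume "(x, y) \<in> R ^^ Suc k"
    then obtain z where "(x, z) \<in> R ^^ k" "(z, y) \<in> R" by auto
    then have "(z, x) \<in> R ^^ k" "(y, z) \<in> R"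
      using Suc assms by (auto dest: symD)
    then show "(y, x) \<in> R ^^ Suc k" by (rule relpow_Suc_I2[rotated])
  qed
qed (simp add: sym_Id)

definition hop_dist :: "'a rel \<Rightarrow> 'a \<Rightarrow> 'a \<Rightarrow> nat" where
  "hop_dist R u v = (LEAST k. (u, v) \<in> R ^^ k)"

lemma relpow_hop_dist: "(u, v) \<in> R\<^sup>* \<Longrightarrow> (u, v) \<in> R ^^ hop_dist R u v"
  unfolding hop_dist_def by (auto dest: rtrancl_imp_relpow intro: LeastI)

lemma hop_dist_le: "(u, v) \<in> R ^^ k \<Longrightarrow> hop_dist R u v \<le> k"
  unfolding hop_dist_def by (rule Least_le)

lemma hop_dist_self [simp]: "hop_dist R u u = 0"
  using hop_dist_le[of u u 0 R] by simp

lemma \<mu>_eq_hop_dist: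
  assumes "pair_wf_digraph G" and "u \<in> pverts G" and "(u, v) \<in> (parcs G)\<^sup>*"
  shows "wf_digraph.\<mu> (with_proj G) (\<lambda>_. 1) u v = ereal (real (hop_dist (parcs G) u v))"
proof -
  interpret wf_digraph "with_proj G" using assms(1) by (simp add: wf_digraph_wp_iff)
  obtain p where p: "awalk u p v" "length p = hop_dist (parcs G) u v"
    using relpow_hop_dist[OF assms(3)] assms(2) by (auto simp: relpow_iff_pcas awalk_with_proj_iff)
  have "hop_dist (parcs G) u v \<le> length q" if "awalk u q v" for q
    using that by (intro hop_dist_le) (auto simp: relpow_iff_pcas awalk_with_proj_iff)
  then have "ereal (real (hop_dist (parcs G) u v)) \<le> \<mu> (\<lambda>_. 1) u v"
    unfolding \<mu>_def by (intro INF_greatest) (auto simp: awalk_cost_def sum_list_triv)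
  moreover have "\<mu> (\<lambda>_. 1) u v \<le> ereal (real (hop_dist (parcs G) u v))"
    using min_cost_le_walk_cost[OF p(1), of "\<lambda>_. 1"] p(2) by (simp add: awalk_cost_def sum_list_triv)
  ultimately show ?thesis by (rule antisym[rotated])
qed

lemma graph_diameter_eq_iff:
  assumes wf: "pair_wf_digraph G" and finite: "finite (pverts G)" and nonempty: "pverts G \<noteq> {}"
    and conn: "\<And>u v. u \<in> pverts G \<Longrightarrow> v \<in> pverts G \<Longrightarrow> (u, v) \<in> (parcs G)\<^sup>*"
  shows "graph_diameter G = ereal (real d) \<longleftrightarrow>
    (\<forall>u\<in>pverts G. \<forall>v\<in>pverts G. hop_dist (parcs G) u v \<le> d) \<and>
    (\<exists>u\<in>pverts G. \<exists>v\<in>pverts G. hop_dist (parcs G) u v = d)"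
proof -
  define \<delta> where "\<delta> = (\<lambda>(u, v). hop_dist (parcs G) u v)"
  let ?D = "\<delta> ` (pverts G \<times> pverts G)"
  have D: "finite ?D" "?D \<noteq> {}" using finite nonempty by auto
  have "graph_diameter G = (SUP u\<in>pverts G. SUP v\<in>pverts G. ereal (real (\<delta> (u, v))))"
    unfolding graph_diameter_def \<delta>_def using wf conn by (simp add: \<mu>_eq_hop_dist cong: SUP_cong)
  also have "\<dots> = ereal (real (Max ?D))"
  proof (rule antisym)
    show "(SUP u\<in>pverts G. SUP v\<in>pverts G. ereal (real (\<delta> (u, v)))) \<le> ereal (real (Max ?D))"
      using D by (intro SUP_least) auto
    obtain u v where "u \<in> pverts G" "v \<in> pverts G" "Max ?D = \<delta> (u, v)"
      using Max_in[OF D] by auto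
    then show "ereal (real (Max ?D)) \<le> (SUP u\<in>pverts G. SUP v\<in>pverts G. ereal (real (\<delta> (u, v))))"
      by (intro SUP_upper2[of u] SUP_upper2[of v]) auto
  qed
  finally have "graph_diameter G = ereal (real d) \<longleftrightarrow> Max ?D = d"
    by simp
  then show ?thesis
    unfolding Max_eq_iff[OF D] by (auto simp: \<delta>_def)
qed

lemma connected_imp_rtrancl:
  assumes "pair_graph G" and "Digraph_Component.connected (with_proj G)"
    and "u \<in> pverts G" "v \<in> pverts G"
  shows "(u, v) \<in> (parcs G)\<^sup>*"
proof -
  interpret pair_graph G by fact
  have wf: "wf_digraph (with_proj G)" by (simp add: wf_digraph_wp_iff pair_wf_digraph)
  have "strongly_connected (with_proj G)"
    using assms(2) pair_sym_arcs
    by (intro wf_digraph.symmetric_connected_imp_strongly_connected[OF wf])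
  then have "u \<rightarrow>\<^sup>*\<^bsub>with_proj G\<^esub> v"
    using assms(3,4) by (auto simp: strongly_connected_def)
  then obtain p where "pre_digraph.awalk (with_proj G) u p v"
    using wf_digraph.reachable_awalk[OF wf] by blast
  then show ?thesis
    unfolding rtrancl_power relpow_iff_pcas awalk_with_proj_iff by auto
qed

lemma connected_verts_nonempty:
  "Digraph_Component.connected (with_proj G) \<Longrightarrow> pverts G \<noteq> {}"
  by (auto simp: connected_def strongly_connected_def mk_symmetric_def)

section \<open>Invariance under isomorphisms\<close>

lemma edges_eq_image: "edges G = (\<lambda>e. {fst e, snd e}) ` parcs G"
  unfolding edges_def by force

lemma (in pair_wf_digraph) parcs_subset: "parcs G \<subseteq> pverts G \<times> pverts G"
  by (auto dest: in_arcsD1 in_arcsD2)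

lemma (in pair_wf_digraph) neighbors_subset: "neighbors G w \<subseteq> pverts G"
  by (auto simp: neighbors_def dest: in_arcsD2)

lemma (in pair_fin_digraph) finite_neighbors: "finite (neighbors G w)"
  using neighbors_subset pair_finite_verts by (rule finite_subset)

locale pair_graph_iso = pair_graph G for G :: "'a pair_pre_digraph" +
  fixes H :: "'b pair_pre_digraph" and g :: "'a \<Rightarrow> 'b"
  assumes inj: "inj_on g (pverts G)"
    and verts_image: "pverts H = g ` pverts G"
    and arcs_image: "parcs H = map_prod g g ` parcs G"
begin

lemma digraph_iso: "digraph_iso (with_proj G) (with_proj H)"
proof -
  define h where "h = \<lparr>iso_verts = g, iso_arcs = map_prod g g, iso_head = snd, iso_tail = fst\<rparr>"
  have "inj_on (map_prod g g) (parcs G)"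
    using map_prod_inj_on[OF inj inj] parcs_subset by (rule inj_on_subset)
  then have "pre_digraph.digraph_isomorphism (with_proj G) h"
    using inj by (auto simp: pre_digraph.digraph_isomorphism_def h_def wf_digraph_wp_iff)
  moreover have "with_proj H = app_iso h (with_proj G)"
    by (simp add: app_iso_def with_proj_def h_def verts_image arcs_image)
  ultimately show ?thesis by (auto simp: digraph_iso_def)
qed

lemma neighbors_image:
  assumes "w \<in> pverts G"
  shows "neighbors H (g w) = g ` neighbors G w"
proof
  show "neighbors H (g w) \<subseteq> g ` neighbors G w"
  proof
    fix y assume "y \<in> neighbors H (g w)"
    then obtain a b where ab: "(a, b) \<in> parcs G" "g a = g w" "y = g b"
      by (auto simp: neighbors_def arcs_image)
    then have "a = w" using inj assms in_arcsD1 by (auto dest: inj_onD)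
    then show "y \<in> g ` neighbors G w" using ab by (auto simp: neighbors_def)
  qed
  show "g ` neighbors G w \<subseteq> neighbors H (g w)"
    by (force simp: neighbors_def arcs_image)
qed

lemma vertex_degree_image: "w \<in> pverts G \<Longrightarrow> vertex_degree H (g w) = vertex_degree G w"
  unfolding vertex_degree_def neighbors_image
  by (rule card_image) (rule inj_on_subset[OF inj neighbors_subset])

lemma card_edges_image: "card (edges H) = card (edges G)"
proof -
  have "edges H = image g ` edges G"
    by (simp add: edges_eq_image arcs_image image_image)
  moreover have "edges G \<subseteq> Pow (pverts G)"
    by (auto simp: edges_def dest: in_arcsD1 in_arcsD2)
  ultimately show ?thesis
    by (simp add: card_image inj_on_subset[OF inj_on_image_Pow[OF inj]])
qed

lemma stationary_image: "w \<in> pverts G \<Longrightarrow> stationary H (g w) = stationary G w"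
  by (simp add: stationary_def vertex_degree_image card_edges_image)

lemma avoid_prob_image:
  assumes v: "v \<in> pverts G" and nb: "\<And>w. w \<in> pverts G - {v} \<Longrightarrow> neighbors G w \<noteq> {}"
    and "u \<in> pverts G"
  shows "avoid_prob H (g v) t (g u) = avoid_prob G v t u"
  using \<open>u \<in> pverts G\<close>
proof (induction t arbitrary: u)
  case 0
  then show ?case
    using inj_on_eq_iff[OF inj 0 v] by (cases "u = v") (simp_all add: avoid_prob_0)
next
  case (Suc t)
  show ?case
  proof (cases "u = v")
    case False
    let ?N = "neighbors G u"
    have "g u \<noteq> g v" using False inj_on_eq_iff[OF inj Suc.prems v] by simp
    moreover have N: "?N \<noteq> {}" using nb Suc.prems False by auto
    ultimately have "avoid_prob H (g v) (Suc t) (g u)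
        = (\<Sum>w\<in>g ` ?N. avoid_prob H (g v) t w) / card (g ` ?N)"
      using finite_neighbors by (simp add: avoid_prob_Suc neighbors_image Suc.prems)
    also have "\<dots> = (\<Sum>w\<in>?N. avoid_prob G v t w) / card ?N"
      using inj_on_subset[OF inj neighbors_subset] neighbors_subset
      by (simp add: card_image sum.reindex Suc.IH subset_iff)
    also have "\<dots> = avoid_prob G v (Suc t) u"
      using False N finite_neighbors by (simp add: avoid_prob_Suc)
    finally show ?thesis .
  qed simp
qed

lemma meeting_time_image:
  assumes "v \<in> pverts G" and "\<And>w. w \<in> pverts G - {v} \<Longrightarrow> neighbors G w \<noteq> {}"
  shows "meeting_time H (g v) = meeting_time G v"
proof -
  have "hitting_time H (g u) (g v) = hitting_time G u v" if "u \<in> pverts G" for u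
    unfolding hitting_time_eq_suminf using avoid_prob_image[OF assms(1) _ that] assms(2) by simp
  then show ?thesis
    unfolding meeting_time_def verts_image sum.reindex[OF inj]
    by (intro sum.cong) (simp_all add: stationary_image)
qed

lemma best_meeting_time_image:
  assumes conn: "Digraph_Component.connected (with_proj G)"
  shows "best_meeting_time H = best_meeting_time G"
proof -
  have "neighbors G w \<noteq> {}" if "v \<in> pverts G" "w \<in> pverts G - {v}" for v w
    using connected_imp_rtrancl[OF pair_graph conn, of w v] that
    by (auto simp: neighbors_def elim: converse_rtranclE)
  then have "meeting_time H (g v) = meeting_time G v" if "v \<in> pverts G" for v
    using that by (intro meeting_time_image)
  then have "meeting_time H ` pverts H = meeting_time G ` pverts G"
    by (simp add: verts_image image_image)
  then show ?thesis by (simp add: best_meeting_time_def)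
qed

end

lemma digraph_iso_imp_pair_graph_iso:
  assumes "pair_graph G" and "digraph_iso (with_proj G) (with_proj H)"
  obtains g where "pair_graph_iso G H g"
proof -
  interpret pair_graph G by fact
  obtain h where h: "pre_digraph.digraph_isomorphism (with_proj G) h"
    and H_eq: "with_proj H = app_iso h (with_proj G)"
    using assms(2) by (auto simp: digraph_iso_def)
  have verts_H: "pverts H = iso_verts h ` pverts G" and arcs_H: "parcs H = iso_arcs h ` parcs G"
    and tail_h: "iso_tail h = fst" and head_h: "iso_head h = snd"
    using arg_cong[OF H_eq, of verts] arg_cong[OF H_eq, of arcs] arg_cong[OF H_eq, of tail]
      arg_cong[OF H_eq, of head] by simp_all
  have "iso_arcs h e = map_prod (iso_verts h) (iso_verts h) e" if "e \<in> parcs G" for e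
    using h that unfolding pre_digraph.digraph_isomorphism_def
    by (auto simp: tail_h head_h map_prod_def split_beta prod_eq_iff)
  then have "parcs H = map_prod (iso_verts h) (iso_verts h) ` parcs G"
    unfolding arcs_H by (rule image_cong[OF refl])
  moreover have "inj_on (iso_verts h) (pverts G)"
    using h by (simp add: pre_digraph.digraph_isomorphism_def)
  ultimately show thesis
    using verts_H by (intro that[of "iso_verts h"]) (unfold_locales, auto)
qed

lemma best_meeting_time_iso:
  assumes "pair_graph G" and "Digraph_Component.connected (with_proj G)"
    and "digraph_iso (with_proj G) (with_proj H)"
  shows "best_meeting_time H = best_meeting_time G"
proof -
  obtain g where "pair_graph_iso G H g"
    using digraph_iso_imp_pair_graph_iso[OF assms(1,3)] .
  then show ?thesis using assms(2) by (rule pair_graph_iso.best_meeting_time_image)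
qed

section \<open>Rooted trees\<close>

locale rooted_tree =
  fixes G :: "'a pair_pre_digraph" and r :: 'a and par :: "'a \<Rightarrow> 'a" and depth :: "'a \<Rightarrow> nat"
  assumes finite_verts: "finite (pverts G)"
    and root_in: "r \<in> pverts G"
    and par_in: "w \<in> pverts G - {r} \<Longrightarrow> par w \<in> pverts G"
    and depth_root: "depth r = 0"
    and depth_par: "w \<in> pverts G - {r} \<Longrightarrow> depth w = Suc (depth (par w))"
    and arcs_eq: "parcs G = {(w, par w) | w. w \<in> pverts G - {r}} \<union> {(par w, w) | w. w \<in> pverts G - {r}}"
begin

lemma par_neq: "w \<in> pverts G - {r} \<Longrightarrow> par w \<noteq> w"
  using depth_par[of w] by auto

lemma sym_parcs: "sym (parcs G)"
  unfolding arcs_eq by (auto intro!: symI)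

lemma pair_graph: "pair_graph G"
proof -
  have subset: "parcs G \<subseteq> pverts G \<times> pverts G"
    unfolding arcs_eq by (auto intro: par_in)
  then have "finite (parcs G)"
    by (rule finite_subset) (simp add: finite_verts)
  moreover have "fst e \<noteq> snd e" if "e \<in> parcs G" for e
    using that par_neq unfolding arcs_eq by force
  moreover have "symmetric (with_proj G)"
    by (simp add: symmetric_def sym_parcs)
  ultimately show ?thesis
    using finite_verts subset by unfold_locales auto
qed

sublocale graph: pair_graph G
  by (rule pair_graph)

lemma depth_eq_0: "w \<in> pverts G \<Longrightarrow> depth w = 0 \<longleftrightarrow> w = r"
  using depth_par[of w] depth_root by (cases "w = r") auto

lemma
  assumes "w \<in> pverts G" and "i \<le> depth w"
  shows funpow_par_in: "(par ^^ i) w \<in> pverts G"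
    and depth_funpow_par: "depth ((par ^^ i) w) = depth w - i"
    and relpow_funpow_par: "(w, (par ^^ i) w) \<in> parcs G ^^ i"
proof -
  have "(par ^^ i) w \<in> pverts G \<and> depth ((par ^^ i) w) = depth w - i
      \<and> (w, (par ^^ i) w) \<in> parcs G ^^ i"
    using assms(2)
  proof (induction i)
    case (Suc i)
    then have nonroot: "(par ^^ i) w \<in> pverts G - {r}" using depth_root by auto
    then have "((par ^^ i) w, (par ^^ Suc i) w) \<in> parcs G" unfolding arcs_eq by auto
    with nonroot Suc par_in[OF nonroot] depth_par[OF nonroot] show ?case by (auto intro: relcompI)
  qed (use assms in auto)
  then show "(par ^^ i) w \<in> pverts G" "depth ((par ^^ i) w) = depth w - i"
    "(w, (par ^^ i) w) \<in> parcs G ^^ i" by auto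
qed

lemma funpow_par_depth: "w \<in> pverts G \<Longrightarrow> (par ^^ depth w) w = r"
  using funpow_par_in[of w "depth w"] depth_funpow_par[of w "depth w"] depth_eq_0 by auto

lemma inj_on_funpow_par: "w \<in> pverts G \<Longrightarrow> inj_on (\<lambda>i. (par ^^ i) w) {..depth w}"
proof (rule inj_onI)
  fix i j assume "w \<in> pverts G" "i \<in> {..depth w}" "j \<in> {..depth w}" "(par ^^ i) w = (par ^^ j) w"
  then show "i = j" using depth_funpow_par[of w i] depth_funpow_par[of w j] by auto
qed

definition children :: "'a \<Rightarrow> 'a set" where
  "children u = {w \<in> pverts G - {r}. par w = u}"

lemma finite_children: "finite (children u)"
  using finite_verts by (simp add: children_def)

lemma childrenD:
  assumes "c \<in> children u"
  shows "c \<in> pverts G - {r}" "par c = u" "depth c = Suc (depth u)"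
  using assms depth_par[of c] by (auto simp: children_def)

lemma leaf_induct [consumes 1, case_names step]:
  assumes "w \<in> pverts G - {r}"
    and step: "\<And>w. w \<in> pverts G - {r} \<Longrightarrow> (\<And>c. c \<in> children w \<Longrightarrow> P c) \<Longrightarrow> P w"
  shows "P w"
  using assms(1)
proof (induction "Max (depth ` pverts G) - depth w" arbitrary: w rule: less_induct)
  case less
  show ?case
  proof (rule step[OF less.prems])
    fix c assume c: "c \<in> children w"
    have "depth c \<le> Max (depth ` pverts G)"
      using finite_verts childrenD(1)[OF c] by (intro Max_ge) auto
    with childrenD[OF c] show "P c" by (intro less.hyps) auto
  qed
qed

lemma neighbors_nonroot: "w \<in> pverts G - {r} \<Longrightarrow> neighbors G w = insert (par w) (children w)"
  unfolding neighbors_def children_def arcs_eq by auto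

lemma sum_neighbors:
  fixes f :: "'a \<Rightarrow> 'b :: comm_monoid_add"
  assumes "w \<in> pverts G - {r}"
  shows "(\<Sum>x\<in>neighbors G w. f x) = f (par w) + (\<Sum>c\<in>children w. f c)"
proof -
  have "par w \<notin> children w"
    using childrenD(3)[of "par w" w] depth_par[OF assms] by auto
  then show ?thesis using assms by (simp add: neighbors_nonroot finite_children)
qed

lemma vertex_degree_nonroot:
  "w \<in> pverts G - {r} \<Longrightarrow> vertex_degree G w = Suc (card (children w))"
  using sum_neighbors[of w "\<lambda>_. 1 :: nat"] by (simp add: vertex_degree_def)

lemma card_edges: "card (edges G) = card (pverts G) - 1"
proof -
  have "edges G = (\<lambda>w. {w, par w}) ` (pverts G - {r})"
    unfolding edges_def arcs_eq by (auto simp: insert_commute)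
  moreover have "inj_on (\<lambda>w. {w, par w}) (pverts G - {r})"
  proof (rule inj_onI)
    fix w x assume "w \<in> pverts G - {r}" "x \<in> pverts G - {r}" "{w, par w} = {x, par x}"
    then show "w = x"
      using depth_par[of w] depth_par[of x] by (auto simp: doubleton_eq_iff)
  qed
  ultimately show ?thesis
    using root_in by (simp add: card_image)
qed

subsection \<open>Subtrees\<close>

definition descendants :: "'a \<Rightarrow> 'a set" where
  "descendants w = {x \<in> pverts G. \<exists>i\<le>depth x. (par ^^ i) x = w}"

definition subtree_size :: "'a \<Rightarrow> nat" where
  "subtree_size w = card (descendants w)"

lemma descendants_subset: "descendants w \<subseteq> pverts G"
  by (auto simp: descendants_def)

lemma finite_descendants: "finite (descendants w)"
  using descendants_subset finite_verts by (rule finite_subset)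

lemma self_in_descendants: "w \<in> pverts G \<Longrightarrow> w \<in> descendants w"
  by (auto simp: descendants_def intro: exI[of _ 0])

lemma root_in_descendants_iff: "r \<in> descendants w \<longleftrightarrow> w = r"
  by (auto simp: descendants_def depth_root root_in)

lemma descendants_par_iff:
  assumes "x \<in> pverts G - {r}"
  shows "x \<in> descendants w \<longleftrightarrow> x = w \<or> par x \<in> descendants w"
proof
  assume "x \<in> descendants w"
  then obtain i where i: "i \<le> depth x" "(par ^^ i) x = w" by (auto simp: descendants_def)
  show "x = w \<or> par x \<in> descendants w"
  proof (cases i)
    case (Suc j)
    then have "j \<le> depth (par x)" "(par ^^ j) (par x) = w"
      using i depth_par[OF assms] by (simp_all add: funpow_swap1)
    then show ?thesis using par_in[OF assms] by (auto simp: descendants_def)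
  qed (use i in simp)
next
  assume "x = w \<or> par x \<in> descendants w"
  then show "x \<in> descendants w"
  proof
    assume "par x \<in> descendants w"
    then obtain j where "j \<le> depth (par x)" "(par ^^ j) (par x) = w"
      by (auto simp: descendants_def)
    then have "Suc j \<le> depth x" "(par ^^ Suc j) x = w"
      using depth_par[OF assms] by (simp_all add: funpow_swap1)
    then show ?thesis using assms unfolding descendants_def by blast
  qed (use assms self_in_descendants in auto)
qed

lemma descendants_depth:
  assumes "x \<in> descendants w"
  shows "depth w \<le> depth x" and "(par ^^ (depth x - depth w)) x = w"
proof -
  obtain i where i: "x \<in> pverts G" "i \<le> depth x" "(par ^^ i) x = w"
    using assms by (auto simp: descendants_def)
  then have "depth w = depth x - i" using depth_funpow_par by auto
  then show "depth w \<le> depth x" and "(par ^^ (depth x - depth w)) x = w" using i by auto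
qed

lemma descendants_eq_children:
  assumes "w \<in> pverts G"
  shows "descendants w = insert w (\<Union>c\<in>children w. descendants c)"
proof (rule antisym; rule subsetI)
  fix x assume "x \<in> descendants w"
  then obtain i where x: "x \<in> pverts G" "i \<le> depth x" "(par ^^ i) x = w"
    by (auto simp: descendants_def)
  show "x \<in> insert w (\<Union>c\<in>children w. descendants c)"
  proof (cases i)
    case (Suc j)
    then have "(par ^^ j) x \<in> children w"
      using x funpow_par_in[of x j] depth_funpow_par[of x j] depth_root by (auto simp: children_def)
    moreover have "x \<in> descendants ((par ^^ j) x)"
      using x Suc by (auto simp: descendants_def intro!: exI[of _ j])
    ultimately show ?thesis by blast
  qed (use x in simp)
next
  fix x assume "x \<in> insert w (\<Union>c\<in>children w. descendants c)"
  then consider "x = w" | c i where "c \<in> children w" "x \<in> pverts G" "i \<le> depth x" "(par ^^ i) x = c"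
    by (auto simp: descendants_def)
  then show "x \<in> descendants w"
  proof cases
    case 1
    then show ?thesis using self_in_descendants[OF assms] by simp
  next
    case 2
    then have "Suc i \<le> depth x" "(par ^^ Suc i) x = w"
      using depth_funpow_par[of x i] childrenD by auto
    then show ?thesis using \<open>x \<in> pverts G\<close> unfolding descendants_def by blast
  qed
qed

lemma sum_descendants:
  fixes f :: "'a \<Rightarrow> 'b :: comm_monoid_add"
  assumes "w \<in> pverts G"
  shows "(\<Sum>x\<in>descendants w. f x) = f w + (\<Sum>c\<in>children w. \<Sum>x\<in>descendants c. f x)"
proof -
  have "descendants b \<inter> descendants c = {}" if "b \<in> children w" "c \<in> children w" "b \<noteq> c" for b c
    using that descendants_depth(2) childrenD(3) by (metis disjoint_iff)
  moreover have "w \<notin> (\<Union>c\<in>children w. descendants c)"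
    using descendants_depth(1) childrenD(3) by force
  ultimately show ?thesis
    unfolding descendants_eq_children[OF assms]
    by (simp add: finite_children finite_descendants sum.UNION_disjoint)
qed

lemma subtree_size_rec:
  "w \<in> pverts G \<Longrightarrow> subtree_size w = 1 + (\<Sum>c\<in>children w. subtree_size c)"
  using sum_descendants[of w "\<lambda>_. 1 :: nat"] by (simp add: subtree_size_def)

lemma subtree_size_unique:
  fixes s :: "'a \<Rightarrow> 'b :: semiring_1"
  assumes rec: "\<And>w. w \<in> pverts G - {r} \<Longrightarrow> s w = 1 + (\<Sum>c\<in>children w. s c)"
    and "w \<in> pverts G - {r}"
  shows "s w = of_nat (subtree_size w)"
  using assms(2)
proof (induction w rule: leaf_induct)
  case (step w)
  then show ?case by (simp add: rec subtree_size_rec)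
qed

lemma sum_vertex_degree_descendants:
  assumes "w \<in> pverts G - {r}"
  shows "Suc (\<Sum>x\<in>descendants w. vertex_degree G x) = 2 * subtree_size w"
  using assms
proof (induction w rule: leaf_induct)
  case (step w)
  have "(\<Sum>c\<in>children w. Suc (\<Sum>x\<in>descendants c. vertex_degree G x))
      = (\<Sum>c\<in>children w. 2 * subtree_size c)"
    using step by (intro sum.cong) auto
  then show ?case
    using step(1)
    by (simp add: sum_descendants subtree_size_rec vertex_degree_nonroot sum_Suc flip: sum_distrib_left)
qed

subsection \<open>Hitting times of the root\<close>

definition ascent_time :: "'a \<Rightarrow> real" where
  "ascent_time w = 2 * real (subtree_size w) - 1"

lemma subtree_size_pos: "w \<in> pverts G \<Longrightarrow> 0 < subtree_size w"
  by (simp add: subtree_size_rec)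

lemma ascent_time_nonneg: "w \<in> pverts G \<Longrightarrow> 0 \<le> ascent_time w"
  using subtree_size_pos[of w] by (simp add: ascent_time_def)

lemma ascent_time_rec:
  "w \<in> pverts G \<Longrightarrow> ascent_time w = 1 + (\<Sum>c\<in>children w. ascent_time c + 1)"
  by (simp add: ascent_time_def subtree_size_rec sum_distrib_left)

lemma ascent_time_unique:
  assumes rec: "\<And>w. w \<in> pverts G - {r} \<Longrightarrow> a w = 1 + (\<Sum>c\<in>children w. a c + 1)"
    and w: "w \<in> pverts G - {r}"
  shows "a w = ascent_time w"
proof -
  have "(a w + 1) / 2 = real (subtree_size w)"
    by (rule subtree_size_unique[OF _ w]) (simp add: rec add_divide_distrib sum_divide_distrib)
  then show ?thesis by (simp add: ascent_time_def)
qed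

definition ancestors :: "'a \<Rightarrow> 'a set" where
  "ancestors u = {w \<in> pverts G - {r}. u \<in> descendants w}"

definition root_time :: "'a \<Rightarrow> real" where
  "root_time u = (\<Sum>w\<in>ancestors u. ascent_time w)"

lemma root_time_root: "root_time r = 0"
proof -
  have "ancestors r = {}" by (auto simp: ancestors_def root_in_descendants_iff)
  then show ?thesis by (simp add: root_time_def)
qed

lemma root_time_par:
  assumes "u \<in> pverts G - {r}"
  shows "root_time u = ascent_time u + root_time (par u)"
proof -
  have "ancestors u = insert u (ancestors (par u))"
    using assms descendants_par_iff[OF assms] by (auto simp: ancestors_def)
  moreover have "u \<notin> ancestors (par u)"
    using descendants_depth(1)[of "par u" u] depth_par[OF assms] by (auto simp: ancestors_def)
  moreover have "finite (ancestors (par u))"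
    using finite_verts by (simp add: ancestors_def)
  ultimately show ?thesis by (simp add: root_time_def)
qed

lemma root_time_nonneg: "0 \<le> root_time u"
  unfolding root_time_def by (intro sum_nonneg ascent_time_nonneg) (auto simp: ancestors_def)

lemma sum_root_time_neighbors:
  assumes w: "w \<in> pverts G - {r}"
  shows "(\<Sum>x\<in>neighbors G w. root_time x) = real (card (neighbors G w)) * (root_time w - 1)"
proof -
  have "(\<Sum>c\<in>children w. root_time c) = (\<Sum>c\<in>children w. root_time w + ascent_time c)"
    using root_time_par childrenD by (intro sum.cong) auto
  then show ?thesis
    using w root_time_par[OF w] ascent_time_rec[of w] sum_neighbors[OF w, of "\<lambda>_. 1 :: nat"]
    by (simp add: sum_neighbors sum.distrib algebra_simps)
qed

lemma hitting_time_root_le: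
  assumes "u \<in> pverts G"
  shows "hitting_time G u r \<le> ennreal (root_time u)"
proof (rule hitting_time_le_supersolution[where S = "pverts G"])
  fix w assume w: "w \<in> pverts G" "w \<noteq> r"
  then show nb: "finite (neighbors G w) \<and> neighbors G w \<noteq> {} \<and> neighbors G w \<subseteq> pverts G"
    using graph.finite_neighbors[of w] graph.neighbors_subset[of w] neighbors_nonroot[of w] by blast
  then have pos: "0 < real (card (neighbors G w))" by (simp add: card_gt_0_iff)
  have "1 + (\<Sum>x\<in>neighbors G w. ennreal (root_time x)) / card (neighbors G w)
      = ennreal (1 + (\<Sum>x\<in>neighbors G w. root_time x) / card (neighbors G w))"
    using pos root_time_nonneg
    by (simp add: sum_nonneg divide_ennreal ennreal_of_nat_eq_real_of_nat flip: ennreal_1 ennreal_plus)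
  also have "\<dots> = ennreal (root_time w)"
    using pos w by (simp add: sum_root_time_neighbors)
  finally show "1 + (\<Sum>x\<in>neighbors G w. ennreal (root_time x)) / card (neighbors G w)
      \<le> ennreal (root_time w)" by simp
qed fact

theorem hitting_time_root:
  assumes "u \<in> pverts G"
  shows "hitting_time G u r = ennreal (root_time u)"
proof -
  define h where "h w = enn2real (hitting_time G w r)" for w
  have h: "hitting_time G w r = ennreal (h w)" if "w \<in> pverts G" for w
    using le_less_trans[OF hitting_time_root_le[OF that] ennreal_less_top] by (simp add: h_def)
  have increment: "h w - h (par w) = ascent_time w" if "w \<in> pverts G - {r}" for w
    using that
  proof (rule ascent_time_unique[rotated])
    fix w assume w: "w \<in> pverts G - {r}"
    have "(\<Sum>x\<in>neighbors G w. h x) = real (card (neighbors G w)) * (h w - 1)"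
    proof (rule hitting_time_step_real)
      show "neighbors G w \<noteq> {}" using neighbors_nonroot[OF w] by simp
      show "hitting_time G x r = ennreal (h x)" if "x \<in> insert w (neighbors G w)" for x
        using that w graph.neighbors_subset[of w] by (intro h) auto
    qed (use w graph.finite_neighbors in \<open>auto simp: h_def\<close>)
    then show "h w - h (par w) = 1 + (\<Sum>c\<in>children w. h c - h (par c) + 1)"
      using sum_neighbors[OF w, of "\<lambda>_. 1 :: nat"]
      by (simp add: sum_neighbors[OF w] sum.distrib sum_subtractf childrenD(2) algebra_simps)
  qed
  have "h w = root_time w" if "w \<in> pverts G" for w
    using that
  proof (induction "depth w" arbitrary: w)
    case 0
    then show ?case
      using depth_eq_0[of w] by (simp add: h_def hitting_time_self root_time_root)
  next
    case (Suc n)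
    then have w: "w \<in> pverts G - {r}" using depth_root by auto
    then have "h (par w) = root_time (par w)"
      using Suc.hyps(2) depth_par[OF w] by (intro Suc.hyps(1) par_in) auto
    then show ?case
      using increment[OF w] root_time_par[OF w] by simp
  qed
  then show ?thesis using h assms by simp
qed

subsection \<open>The meeting time at the root\<close>

text \<open>
  Each \<open>ascent_time w\<close> is charged to the descendants of \<open>w\<close> in proportion to their degrees, and
  these degrees again add up to \<open>ascent_time w\<close>.
\<close>

lemma sum_degree_root_time:
  "(\<Sum>u\<in>pverts G. real (vertex_degree G u) * root_time u) = (\<Sum>w\<in>pverts G - {r}. (ascent_time w)\<^sup>2)"
proof -
  define f where "f u w = real (vertex_degree G u) * ascent_time w" for u w
  have degrees: "(\<Sum>u\<in>descendants w. f u w) = (ascent_time w)\<^sup>2" if "w \<in> pverts G - {r}" for w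
  proof -
    have "(\<Sum>u\<in>descendants w. real (vertex_degree G u)) = ascent_time w"
      using arg_cong[OF sum_vertex_degree_descendants[OF that], of real] by (simp add: ascent_time_def)
    then show ?thesis by (simp add: f_def power2_eq_square flip: sum_distrib_right)
  qed
  have "(\<Sum>u\<in>pverts G. real (vertex_degree G u) * root_time u)
      = (\<Sum>u\<in>pverts G. \<Sum>w\<in>{w \<in> pverts G - {r}. u \<in> descendants w}. f u w)"
    by (simp add: root_time_def ancestors_def sum_distrib_left f_def)
  also have "\<dots> = (\<Sum>w\<in>pverts G - {r}. \<Sum>u\<in>{u \<in> pverts G. u \<in> descendants w}. f u w)"
    using finite_verts by (intro sum.swap_restrict) auto
  also have "\<dots> = (\<Sum>w\<in>pverts G - {r}. \<Sum>u\<in>descendants w. f u w)"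
    using descendants_subset by (intro sum.cong refl) auto
  also have "\<dots> = (\<Sum>w\<in>pverts G - {r}. (ascent_time w)\<^sup>2)"
    by (intro sum.cong refl degrees)
  finally show ?thesis .
qed

definition subtree_pairs :: nat where
  "subtree_pairs = (\<Sum>w\<in>pverts G - {r}. subtree_size w choose 2)"

lemma sum_ascent_time_squares:
  "(\<Sum>w\<in>pverts G - {r}. (ascent_time w)\<^sup>2) = (real (card (pverts G)) - 1) + 8 * real subtree_pairs"
proof -
  have "(ascent_time w)\<^sup>2 = 1 + 8 * real (subtree_size w choose 2)" for w
    unfolding ascent_time_def real_choose_two
    by (simp add: power2_eq_square algebra_simps diff_divide_distrib)
  then show ?thesis
    using root_in finite_verts card_gt_0_iff[of "pverts G"]
    by (auto simp: subtree_pairs_def sum.distrib sum_distrib_left of_nat_diff Suc_le_eq)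
qed

theorem meeting_time_root:
  assumes "2 \<le> card (pverts G)"
  shows "meeting_time G r = ennreal (1 / 2 + 4 * real subtree_pairs / (real (card (pverts G)) - 1))"
proof -
  let ?n = "real (card (pverts G))"
  have n: "0 < ?n - 1" and edges: "real (card (edges G)) = ?n - 1"
    using assms by (simp_all add: card_edges of_nat_diff)
  have stationary_nonneg: "0 \<le> stationary G u" for u by (simp add: stationary_def)
  have "meeting_time G r = (\<Sum>u\<in>pverts G. ennreal (stationary G u * root_time u))"
    unfolding meeting_time_def
    by (intro sum.cong) (simp_all add: hitting_time_root ennreal_mult root_time_nonneg
        stationary_nonneg)
  also have "\<dots> = ennreal (\<Sum>u\<in>pverts G. stationary G u * root_time u)"
    by (intro sum_ennreal mult_nonneg_nonneg root_time_nonneg stationary_nonneg)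
  also have "(\<Sum>u\<in>pverts G. stationary G u * root_time u)
      = (\<Sum>u\<in>pverts G. real (vertex_degree G u) * root_time u) / (2 * (?n - 1))"
    by (simp add: stationary_def sum_divide_distrib edges)
  also have "\<dots> = 1 / 2 + 4 * real subtree_pairs / (?n - 1)"
    unfolding sum_degree_root_time sum_ascent_time_squares using n by (simp add: field_simps)
  finally show ?thesis .
qed

end

section \<open>Undirected trees as rooted trees\<close>

lemma pawalk_verts_conv: "pcas u p v \<Longrightarrow> pawalk_verts u p = u # map snd p"
  by (induction p arbitrary: u) auto

lemma fst_nth_pcas:
  "pcas u p v \<Longrightarrow> i < length p \<Longrightarrow> fst (p ! i) = (if i = 0 then u else snd (p ! (i - 1)))"
  by (induction p arbitrary: u i) (auto simp: nth_Cons split: nat.split)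

lemma snd_last_pcas: "pcas u p v \<Longrightarrow> p \<noteq> [] \<Longrightarrow> snd (last p) = v"
  by (induction p arbitrary: u) auto

lemma fst_nth_closed_pcas:
  assumes "pcas u p u" and "i < length p"
  shows "fst (p ! i) = snd (p ! (if i = 0 then length p - 1 else i - 1))"
  using fst_nth_pcas[OF assms] snd_last_pcas[OF assms(1)] assms(2) by (auto simp: last_conv_nth)

lemma cycle_vertex_two_neighbors:
  assumes cyc: "pre_digraph.cycle (with_proj G) p" and len: "3 \<le> length p" and w: "w \<in> snd ` set p"
  obtains x y where "x \<in> snd ` set p" "y \<in> snd ` set p" "x \<noteq> y" "(x, w) \<in> parcs G" "(w, y) \<in> parcs G"
proof -
  obtain u where p: "set p \<subseteq> parcs G" "pcas u p u" and "distinct (tl (pawalk_verts u p))"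
    using cyc unfolding pre_digraph.cycle_def awalk_with_proj_iff awalk_verts_with_proj_eq by auto
  then have dist: "distinct (map snd p)" by (simp add: pawalk_verts_conv)
  obtain i where i: "i < length p" "w = snd (p ! i)"
    using w by (auto simp: in_set_conv_nth)
  define j where "j = (if i = 0 then length p - 1 else i - 1)"
  define k where "k = (if Suc i = length p then 0 else Suc i)"
  have jk: "j < length p" "k < length p" "j \<noteq> k"
    using i(1) len by (auto simp: j_def k_def)
  have "p ! i = (snd (p ! j), w)"
    using fst_nth_closed_pcas[OF p(2) i(1)] i(2) by (simp add: j_def prod_eq_iff)
  moreover have "p ! k = (w, snd (p ! k))"
    using fst_nth_closed_pcas[OF p(2) jk(2)] i diff_Suc_1[of i]
    by (cases "Suc i = length p") (simp_all add: k_def prod_eq_iff)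
  moreover have "snd (p ! j) \<noteq> snd (p ! k)"
    using nth_eq_iff_index_eq[OF dist, of j k] jk by simp
  ultimately show thesis
    using p(1) i(1) jk
    by (intro that[of "snd (p ! j)" "snd (p ! k)"]) (metis nth_mem image_eqI subsetD)+
qed

lemma hop_dist_step:
  assumes "(w, r) \<in> R\<^sup>*" and "w \<noteq> r"
  obtains x where "(w, x) \<in> R" "(x, r) \<in> R\<^sup>*" "hop_dist R w r = Suc (hop_dist R x r)"
proof (cases "hop_dist R w r")
  case 0
  then show thesis using relpow_hop_dist[OF assms(1)] assms(2) by simp
next
  case (Suc k)
  then obtain x where x: "(w, x) \<in> R" "(x, r) \<in> R ^^ k"
    using relpow_hop_dist[OF assms(1)] by (metis relpow_Suc_D2)
  then have xr: "(x, r) \<in> R\<^sup>*" by (blast intro: relpow_imp_rtrancl)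
  have "hop_dist R w r \<le> Suc (hop_dist R x r)"
    using x(1) relpow_hop_dist[OF xr] by (intro hop_dist_le relpow_Suc_I2)
  then have "hop_dist R w r = Suc (hop_dist R x r)"
    using hop_dist_le[OF x(2)] Suc by simp
  with x(1) xr show thesis by (rule that)
qed

lemma closer_vertex_rtrancl_avoiding:
  assumes "(w, r) \<in> R\<^sup>*" and "w \<noteq> u" and "hop_dist R w r \<le> hop_dist R u r"
  shows "(w, r) \<in> (Restr R (- {u}))\<^sup>*"
  using assms
proof (induction "hop_dist R w r" arbitrary: w rule: less_induct)
  case less
  show ?case
  proof (cases "w = r")
    case False
    then obtain x where x: "(w, x) \<in> R" "(x, r) \<in> R\<^sup>*" "hop_dist R w r = Suc (hop_dist R x r)"
      using less.prems(1) by (auto elim: hop_dist_step)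
    then have "x \<noteq> u" using less.prems(3) by auto
    then have "(x, r) \<in> (Restr R (- {u}))\<^sup>*"
      using x less.prems(3) by (intro less.hyps) auto
    moreover have "(w, x) \<in> Restr R (- {u})"
      using x(1) \<open>x \<noteq> u\<close> less.prems(2) by simp
    ultimately show ?thesis by (rule converse_rtrancl_into_rtrancl[rotated])
  qed simp
qed

lemma undirected_tree_bridge:
  assumes G: "undirected_tree G" and ux: "(u, x) \<in> parcs G"
  shows "(x, u) \<notin> (parcs G - {(u, x), (x, u)})\<^sup>*"
proof
  interpret G: pair_graph G using G by (simp add: undirected_tree_def)
  define H where "H = G\<lparr>parcs := parcs G - {(u, x), (x, u)}\<rparr>"
  have H: "pverts H = pverts G" "parcs H = parcs G - {(u, x), (x, u)}"
    by (simp_all add: H_def)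
  have "pair_wf_digraph H"
    by unfold_locales (auto simp: H dest: G.in_arcsD1 G.in_arcsD2)
  then interpret H: wf_digraph "with_proj H" by (simp add: wf_digraph_wp_iff)
  have neq: "u \<noteq> x" using G.no_loops' ux by auto
  assume "(x, u) \<in> (parcs G - {(u, x), (x, u)})\<^sup>*"
  then obtain q where "H.awalk x q u"
    using G.in_arcsD2[OF ux] unfolding H(2)[symmetric] rtrancl_power
    by (auto simp: relpow_iff_pcas awalk_with_proj_iff H(1))
  from H.apath_awalk_to_apath[OF this] obtain p where "H.apath x p u" by blast
  then have p: "set p \<subseteq> parcs H" "pcas x p u" "distinct (pawalk_verts x p)"
    by (auto simp: H.apath_def awalk_with_proj_iff awalk_verts_with_proj_eq)
  have "2 \<le> length p"
  proof (cases p)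
    case Nil then show ?thesis using p neq by simp
  next
    case (Cons e q)
    then show ?thesis using p H by (cases q) (auto simp: H)
  qed
  moreover have "pre_digraph.cycle (with_proj G) ((u, x) # p)"
    unfolding pre_digraph.cycle_def awalk_with_proj_iff awalk_verts_with_proj_eq
    using p ux G.in_arcsD1[OF ux] by (intro exI[of _ u]) (auto simp: H)
  ultimately show False
    using G unfolding undirected_tree_def by fastforce
qed

lemma undirected_tree_rtrancl:
  "undirected_tree G \<Longrightarrow> u \<in> pverts G \<Longrightarrow> v \<in> pverts G \<Longrightarrow> (u, v) \<in> (parcs G)\<^sup>*"
  by (simp add: undirected_tree_def connected_imp_rtrancl)

lemma undirected_tree_sym: "undirected_tree G \<Longrightarrow> sym (parcs G)"
  unfolding undirected_tree_def pair_graph_def pair_pseudo_graph_def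
  by (auto intro!: symI dest: pair_sym_digraph.arcs_symmetric)

lemma undirected_tree_unique_closer_neighbor:
  assumes G: "undirected_tree G" and r: "r \<in> pverts G"
    and arcs: "(u, x) \<in> parcs G" "(u, y) \<in> parcs G"
    and closer: "hop_dist (parcs G) x r \<le> hop_dist (parcs G) u r"
      "hop_dist (parcs G) y r \<le> hop_dist (parcs G) u r"
  shows "x = y"
proof (rule ccontr)
  assume "x \<noteq> y"
  interpret G: pair_graph G using G by (simp add: undirected_tree_def)
  let ?R = "Restr (parcs G) (- {u})"
  have to_root: "(z, r) \<in> ?R\<^sup>*"
    if "(u, z) \<in> parcs G" "hop_dist (parcs G) z r \<le> hop_dist (parcs G) u r" for z
    using that G.no_loops'[OF that(1)] undirected_tree_rtrancl[OF G G.in_arcsD2[OF that(1)] r]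
    by (intro closer_vertex_rtrancl_avoiding) auto
  have "sym ?R" using undirected_tree_sym[OF G] by (auto simp: sym_def)
  then have "(r, y) \<in> ?R\<^sup>*"
    using to_root[OF arcs(2) closer(2)] by (blast dest: sym_rtrancl symD)
  with to_root[OF arcs(1) closer(1)] have "(x, y) \<in> ?R\<^sup>*" by (rule rtrancl_trans)
  moreover have "?R\<^sup>* \<subseteq> (parcs G - {(u, x), (x, u)})\<^sup>*"
    by (rule rtrancl_mono) auto
  moreover have "(y, u) \<in> parcs G - {(u, x), (x, u)}"
    using arcs(2) undirected_tree_sym[OF G] \<open>x \<noteq> y\<close> G.no_loops'[OF arcs(2)] by (auto dest: symD)
  ultimately have "(x, u) \<in> (parcs G - {(u, x), (x, u)})\<^sup>*"
    by (blast intro: rtrancl_into_rtrancl)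
  then show False using undirected_tree_bridge[OF G arcs(1)] by blast
qed

theorem undirected_tree_imp_rooted_tree:
  assumes G: "undirected_tree G" and r: "r \<in> pverts G"
  obtains par depth where "rooted_tree G r par depth"
proof -
  interpret G: pair_graph G using G by (simp add: undirected_tree_def)
  let ?E = "parcs G" and ?V = "pverts G"
  let ?depth = "\<lambda>w. hop_dist ?E w r"
  have "\<exists>x. (w, x) \<in> ?E \<and> ?depth w = Suc (?depth x)" if "w \<in> ?V - {r}" for w
    using undirected_tree_rtrancl[OF G _ r] that by (auto elim: hop_dist_step[of w r ?E])
  then obtain par where par: "\<And>w. w \<in> ?V - {r} \<Longrightarrow> (w, par w) \<in> ?E \<and> ?depth w = Suc (?depth (par w))"
    by metis
  have unique: "x = par u" if ux: "(u, x) \<in> ?E" and "u \<noteq> r" and "?depth x \<le> ?depth u" for u x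
    using undirected_tree_unique_closer_neighbor[OF G r ux _ that(3), of "par u"] par[of u]
      G.in_arcsD1[OF ux] that(2) by simp
  have "rooted_tree G r par ?depth"
  proof
    show "finite ?V" by (rule G.pair_finite_verts)
    show "r \<in> ?V" by fact
    show "par w \<in> ?V" if "w \<in> ?V - {r}" for w
      using par[OF that] by (auto dest: G.in_arcsD2)
    show "?depth w = Suc (?depth (par w))" if "w \<in> ?V - {r}" for w
      using par[OF that] by simp
    show "?E = {(w, par w) | w. w \<in> ?V - {r}} \<union> {(par w, w) | w. w \<in> ?V - {r}}" (is "_ = ?R")
    proof (rule antisym; rule subrelI)
      fix u x assume ux: "(u, x) \<in> ?E"
      note xu = symD[OF undirected_tree_sym[OF G] ux]
      have neq: "u \<noteq> x" using G.no_loops' ux by auto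
      have "u \<noteq> r" if "?depth x \<le> ?depth u"
        using that neq relpow_hop_dist[OF undirected_tree_rtrancl[OF G G.in_arcsD2[OF ux] r]] by auto
      moreover have "x \<noteq> r" if "?depth u \<le> ?depth x"
        using that neq relpow_hop_dist[OF undirected_tree_rtrancl[OF G G.in_arcsD1[OF ux] r]] by auto
      ultimately have "x = par u \<and> u \<noteq> r \<or> u = par x \<and> x \<noteq> r"
        using unique[OF ux] unique[OF xu] by (meson le_cases)
      then show "(u, x) \<in> ?R" using G.in_arcsD1[OF ux] G.in_arcsD2[OF ux] by auto
    next
      fix u x assume "(u, x) \<in> ?R"
      then show "(u, x) \<in> ?E" using par undirected_tree_sym[OF G] by (blast dest: symD)
    qed
  qed simp
  then show thesis by (rule that)
qed

context rooted_tree
begin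

lemma arc_to_lower_depth:
  assumes "(u, x) \<in> parcs G" and "depth x \<le> depth u"
  shows "x = par u"
  using assms depth_par[of x] unfolding arcs_eq by auto

lemma no_long_cycle:
  assumes cyc: "pre_digraph.cycle (with_proj G) p" and len: "3 \<le> length p"
  shows False
proof -
  let ?W = "snd ` set p"
  have depths: "finite (depth ` ?W)" "depth ` ?W \<noteq> {}" using len by auto
  \<comment> \<open>Both cycle neighbours of a deepest vertex would be its parent.\<close>
  obtain w where w: "w \<in> ?W" "Max (depth ` ?W) = depth w" using Max_in[OF depths] by auto
  obtain x y where xy: "x \<in> ?W" "y \<in> ?W" "x \<noteq> y" "(x, w) \<in> parcs G" "(w, y) \<in> parcs G"
    using cycle_vertex_two_neighbors[OF cyc len w(1)] .
  have deepest: "depth z \<le> depth w" if "z \<in> ?W" for z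
    using that depths(1) unfolding w(2)[symmetric] by (intro Max_ge) auto
  have "x = par w"
    using symD[OF sym_parcs xy(4)] deepest[OF xy(1)] by (rule arc_to_lower_depth)
  moreover have "y = par w"
    using xy(5) deepest[OF xy(2)] by (rule arc_to_lower_depth)
  ultimately show False using xy(3) by simp
qed

lemma relpow_depths:
  assumes "u \<in> pverts G" and "v \<in> pverts G"
  shows "(u, v) \<in> parcs G ^^ (depth u + depth v)"
proof -
  have "(u, r) \<in> parcs G ^^ depth u" "(r, v) \<in> parcs G ^^ depth v"
    using relpow_funpow_par[OF _ order_refl] funpow_par_depth assms sym_relpow[OF sym_parcs]
    by (metis symD)+
  then show ?thesis by (auto simp: relpow_add)
qed

lemma connected: "Digraph_Component.connected (with_proj G)"
proof -
  have "mk_symmetric (with_proj G) = G"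
    using sym_parcs by (intro pair_pre_digraph.equality) (auto simp: mk_symmetric_def dest: symD)
  moreover have "u \<rightarrow>\<^sup>*\<^bsub>with_proj G\<^esub> v" if "u \<in> pverts G" "v \<in> pverts G" for u v
    using that relpow_depths[OF that]
    by (auto simp: graph.reachable_awalk relpow_iff_pcas awalk_with_proj_iff)
  ultimately show ?thesis
    using root_in by (auto simp: connected_def strongly_connected_def)
qed

theorem undirected_tree: "undirected_tree G"
  unfolding undirected_tree_def using pair_graph connected no_long_cycle by blast

end

lemma undirected_tree_graph_diameter_eq_iff:
  assumes "undirected_tree G"
  shows "graph_diameter G = ereal (real d) \<longleftrightarrow>
    (\<forall>u\<in>pverts G. \<forall>v\<in>pverts G. hop_dist (parcs G) u v \<le> d) \<and>
    (\<exists>u\<in>pverts G. \<exists>v\<in>pverts G. hop_dist (parcs G) u v = d)"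
proof -
  interpret pair_graph G using assms by (simp add: undirected_tree_def)
  show ?thesis
    using assms undirected_tree_rtrancl[OF assms] pair_finite_verts pair_wf_digraph
    by (intro graph_diameter_eq_iff connected_verts_nonempty) (auto simp: undirected_tree_def)
qed

section \<open>Pairs of vertices in a forked tree\<close>

definition fork_pairs :: "nat \<Rightarrow> nat \<Rightarrow> nat" where
  "fork_pairs k l = (Suc k choose 3) + (Suc l choose 3)"

lemma fork_pairs_commute: "fork_pairs k l = fork_pairs l k"
  by (simp add: fork_pairs_def)

lemma
  assumes "d \<le> k + l"
  shows fork_pairs_balanced_le: "fork_pairs (d div 2) (d - d div 2) \<le> fork_pairs k l"
    and fork_pairs_eq_balanced: "2 \<le> d \<Longrightarrow> fork_pairs k l = fork_pairs (d div 2) (d - d div 2) \<Longrightarrow>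
      k = d div 2 \<and> l = d - d div 2 \<or> k = d - d div 2 \<and> l = d div 2"
proof -
  define f where "f i = real (Suc i choose 3)" for i
  have \<Delta>: "f (Suc i) - f i = real (Suc i choose 2)" for i
    by (simp add: f_def numeral_3_eq_3 numeral_2_eq_2)
  have "strict_mono (\<lambda>i. f (Suc i) - f i)"
    unfolding \<Delta> by (intro strict_monoI) (simp add: choose_two_less)
  note balanced_le = strictly_convex_nat_balanced_split_le[OF this assms]
    and balanced_unique = strictly_convex_nat_balanced_split_unique[OF this assms]
  have fork: "real (fork_pairs i j) = f i + f j" for i j
    by (simp add: fork_pairs_def f_def)
  have "f (d div 2) \<le> f (Suc (d div 2))" using \<Delta>[of "d div 2"] by simp
  then show "fork_pairs (d div 2) (d - d div 2) \<le> fork_pairs k l"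
    using balanced_le unfolding of_nat_le_iff[where 'a = real, symmetric] fork by simp
  assume "2 \<le> d" and eq: "fork_pairs k l = fork_pairs (d div 2) (d - d div 2)"
  then have "0 < real (Suc (d div 2) choose 2)"
    by (simp add: zero_less_binomial_iff)
  then have "f (d div 2) < f (Suc (d div 2))" using \<Delta>[of "d div 2"] by linarith
  then show "k = d div 2 \<and> l = d - d div 2 \<or> k = d - d div 2 \<and> l = d div 2"
    using balanced_unique eq unfolding of_nat_eq_iff[where 'a = real, symmetric] fork by simp
qed

context rooted_tree
begin

definition trail :: "'a \<Rightarrow> nat \<Rightarrow> 'a set" where
  "trail w k = (\<lambda>i. (par ^^ i) w) ` {..<k}"

lemma inj_on_trail:
  assumes "w \<in> pverts G" and "k \<le> Suc (depth w)"
  shows "inj_on (\<lambda>i. (par ^^ i) w) {..<k}"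
  by (rule inj_on_subset[OF inj_on_funpow_par]) (use assms in auto)

lemma finite_trail: "finite (trail w k)"
  by (simp add: trail_def)

lemma card_trail: "w \<in> pverts G \<Longrightarrow> k \<le> Suc (depth w) \<Longrightarrow> card (trail w k) = k"
  using card_image[OF inj_on_trail] by (simp add: trail_def)

lemma sum_trail:
  "w \<in> pverts G \<Longrightarrow> k \<le> Suc (depth w) \<Longrightarrow> (\<Sum>x\<in>trail w k. f x) = (\<Sum>i<k. f ((par ^^ i) w))"
  using sum.reindex[OF inj_on_trail] by (simp add: trail_def)

lemma trail_subset:
  assumes "w \<in> pverts G" and "k \<le> depth w"
  shows "trail w k \<subseteq> pverts G - {r}"
proof
  fix x assume "x \<in> trail w k"
  then obtain i where "i < k" "x = (par ^^ i) w" by (auto simp: trail_def)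
  then show "x \<in> pverts G - {r}"
    using assms funpow_par_in[of w i] depth_funpow_par[of w i] depth_root by auto
qed

lemma trail_subset_descendants:
  assumes "w \<in> pverts G" and "i \<le> depth w"
  shows "trail w (Suc i) \<subseteq> descendants ((par ^^ i) w)"
proof
  fix x assume "x \<in> trail w (Suc i)"
  then obtain j where j: "j \<le> i" "x = (par ^^ j) w" by (auto simp: trail_def less_Suc_eq_le)
  then have "(par ^^ (i - j)) x = (par ^^ i) w"
    using fun_cong[OF funpow_add[of "i - j" j par], of w] by simp
  moreover have "x \<in> pverts G" "i - j \<le> depth x"
    using j assms funpow_par_in[of w j] depth_funpow_par[of w j] by auto
  ultimately show "x \<in> descendants ((par ^^ i) w)" by (auto simp: descendants_def)
qed

lemma subtree_size_funpow_par_ge: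
  "w \<in> pverts G \<Longrightarrow> i \<le> depth w \<Longrightarrow> Suc i \<le> subtree_size ((par ^^ i) w)"
  using card_mono[OF finite_descendants trail_subset_descendants, of w i] card_trail[of w "Suc i"]
  by (simp add: subtree_size_def)

lemma descendants_eq_trail:
  assumes "w \<in> pverts G" and "i \<le> depth w" and "subtree_size ((par ^^ i) w) = Suc i"
  shows "descendants ((par ^^ i) w) = trail w (Suc i)"
  using assms card_trail[of w "Suc i"]
  by (intro card_subset_eq[symmetric] finite_descendants trail_subset_descendants)
     (simp_all add: subtree_size_def)

lemma subtree_size_1_imp_leaf:
  "w \<in> pverts G \<Longrightarrow> subtree_size w = 1 \<Longrightarrow> descendants w = {w}"
  using descendants_eq_trail[of w 0] by (simp add: trail_def lessThan_Suc)

lemma choose_three_le_sum_trail: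
  assumes "w \<in> pverts G" and "k \<le> depth w"
  shows "Suc k choose 3 \<le> (\<Sum>x\<in>trail w k. subtree_size x choose 2)"
  unfolding sum_Suc_choose_two[symmetric] using assms
  by (simp add: sum_trail) (intro sum_mono binomial_right_mono subtree_size_funpow_par_ge, auto)

lemma trail_closed_under_descendants:
  assumes w: "w \<in> pverts G" "k \<le> depth w"
    and tight: "(\<Sum>x\<in>trail w k. subtree_size x choose 2) = Suc k choose 3"
    and x: "x \<in> trail w k"
  shows "descendants x \<subseteq> trail w k"
proof -
  obtain i where i: "i < k" "x = (par ^^ i) w" using x by (auto simp: trail_def)
  have size_ge: "Suc j \<le> subtree_size ((par ^^ j) w)" if "j < k" for j
    using that w by (intro subtree_size_funpow_par_ge) auto
  have "(\<Sum>j<k. Suc j choose 2) = (\<Sum>j<k. subtree_size ((par ^^ j) w) choose 2)"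
    using tight w by (simp add: sum_trail sum_Suc_choose_two)
  then have "Suc i choose 2 = subtree_size x choose 2"
    unfolding i(2) by (rule sum_mono_inv) (use i size_ge in \<open>auto intro: binomial_right_mono\<close>)
  then have "subtree_size x = Suc i"
    using choose_two_less[of "Suc i" "subtree_size x"] size_ge[OF i(1)] i(2) by fastforce
  then have "descendants x = trail w (Suc i)"
    unfolding i(2) using i(1) w by (intro descendants_eq_trail) auto
  also have "\<dots> \<subseteq> trail w k" using i(1) by (auto simp: trail_def)
  finally show ?thesis .
qed

end

locale forked_tree = rooted_tree +
  fixes u v :: 'a and k l :: nat
  assumes u_in: "u \<in> pverts G" and v_in: "v \<in> pverts G"
    and k_le: "k \<le> depth u" and l_le: "l \<le> depth v"
    and meet: "(par ^^ k) u = (par ^^ l) v"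
    and disjoint: "trail u k \<inter> trail v l = {}"
begin

lemma swap: "forked_tree G r par depth v u l k"
  using meet disjoint by unfold_locales (auto simp: u_in v_in k_le l_le)

definition off_trails :: "'a set" where
  "off_trails = pverts G - {r} - (trail u k \<union> trail v l)"

lemma finite_off_trails: "finite off_trails"
  using finite_verts by (simp add: off_trails_def)

lemma subtree_pairs_split:
  "subtree_pairs = (\<Sum>w\<in>trail u k. subtree_size w choose 2) + (\<Sum>w\<in>trail v l. subtree_size w choose 2)
    + (\<Sum>w\<in>off_trails. subtree_size w choose 2)"
proof -
  have "pverts G - {r} = (trail u k \<union> trail v l) \<union> off_trails"
    using trail_subset[OF u_in k_le] trail_subset[OF v_in l_le] by (auto simp: off_trails_def)
  moreover have "(trail u k \<union> trail v l) \<inter> off_trails = {}"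
    by (auto simp: off_trails_def)
  ultimately show ?thesis
    using disjoint by (simp add: subtree_pairs_def sum.union_disjoint finite_trail finite_off_trails)
qed

theorem fork_pairs_le_subtree_pairs: "fork_pairs k l \<le> subtree_pairs"
  unfolding fork_pairs_def subtree_pairs_split
  by (intro trans_le_add1 add_mono choose_three_le_sum_trail u_in v_in k_le l_le)

context
  assumes tight: "subtree_pairs = fork_pairs k l"
begin

lemma tight_sums:
  "(\<Sum>w\<in>trail u k. subtree_size w choose 2) = Suc k choose 3"
  "(\<Sum>w\<in>off_trails. subtree_size w choose 2) = 0"
  using tight choose_three_le_sum_trail[OF u_in k_le] choose_three_le_sum_trail[OF v_in l_le]
  unfolding subtree_pairs_split fork_pairs_def by linarith+

lemma tight_descendants_trail: "w \<in> trail u k \<Longrightarrow> descendants w \<subseteq> trail u k"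
  using u_in k_le tight_sums(1) by (rule trail_closed_under_descendants)

lemma tight_descendants_off_trails:
  assumes "w \<in> off_trails"
  shows "descendants w = {w}"
proof -
  have "subtree_size w choose 2 = 0"
    using tight_sums(2) assms finite_off_trails by simp
  then have "subtree_size w < 2" by (simp add: binomial_eq_0_iff)
  moreover have w: "w \<in> pverts G" using assms by (simp add: off_trails_def)
  ultimately show ?thesis
    using subtree_size_pos[OF w] by (intro subtree_size_1_imp_leaf) auto
qed

lemma tight_apex:
  assumes "0 < k"
  shows "(par ^^ k) u = r"
proof (rule ccontr)
  let ?a = "(par ^^ k) u"
  assume neq: "?a \<noteq> r"
  have off: "(par ^^ i) w \<notin> trail w i" if "w \<in> pverts G" "i \<le> depth w" for w i
    using inj_onD[OF inj_on_funpow_par[OF that(1)], of i] that(2) by (force simp: trail_def)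
  have "?a \<in> off_trails"
    using neq off[OF u_in k_le] off[OF v_in l_le] meet funpow_par_in[OF u_in k_le]
    by (simp add: off_trails_def)
  then have "trail u (Suc k) \<subseteq> {?a}"
    using trail_subset_descendants[OF u_in k_le] tight_descendants_off_trails by auto
  then have "card (trail u (Suc k)) \<le> 1" using card_mono[of "{?a}"] by simp
  then show False using card_trail[OF u_in, of "Suc k"] k_le \<open>0 < k\<close> by simp
qed

end

lemma tight_par_off_trails:
  assumes tight: "subtree_pairs = fork_pairs k l" and w: "w \<in> off_trails"
  shows "par w = r"
proof (rule ccontr)
  assume neq: "par w \<noteq> r"
  have wV: "w \<in> pverts G - {r}" using w by (simp add: off_trails_def)
  have desc: "w \<in> descendants (par w)"
    using descendants_par_iff[OF wV] self_in_descendants[OF par_in[OF wV]] by simp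
  have "par w \<notin> trail u k"
    using tight_descendants_trail[OF tight] desc w by (auto simp: off_trails_def)
  moreover have "par w \<notin> trail v l"
    using forked_tree.tight_descendants_trail[OF swap tight[unfolded fork_pairs_commute[of k]]] desc w
    by (auto simp: off_trails_def)
  ultimately have "par w \<in> off_trails"
    using neq par_in[OF wV] by (simp add: off_trails_def)
  then show False
    using tight_descendants_off_trails[OF tight] desc par_neq[OF wV] by auto
qed

end

theorem (in rooted_tree) distance_imp_forked_tree:
  assumes uv: "u \<in> pverts G" "v \<in> pverts G"
  obtains k l where "forked_tree G r par depth u v k l" "hop_dist (parcs G) u v \<le> k + l"
proof -
  define meets where "meets k \<longleftrightarrow> k \<le> depth u \<and> (\<exists>l\<le>depth v. (par ^^ k) u = (par ^^ l) v)" for k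
  have "meets (depth u)"
    unfolding meets_def using funpow_par_depth[OF uv(1)] funpow_par_depth[OF uv(2)]
    by (auto intro!: exI[of _ "depth v"])
  define k where "k = (LEAST k. meets k)"
  have "meets k" unfolding k_def using \<open>meets (depth u)\<close> by (rule LeastI)
  then obtain l where kl: "k \<le> depth u" "l \<le> depth v" "(par ^^ k) u = (par ^^ l) v"
    by (auto simp: meets_def)
  have "trail u k \<inter> trail v l = {}"
  proof -
    have "(par ^^ i) u \<noteq> (par ^^ j) v" if "i < k" "j < l" for i j
    proof
      assume "(par ^^ i) u = (par ^^ j) v"
      then have "meets i" using that kl by (auto simp: meets_def intro!: exI[of _ j])
      then show False using not_less_Least[of i meets] \<open>i < k\<close> by (simp add: k_def)
    qed
    then show ?thesis by (auto simp: trail_def)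
  qed
  then have "forked_tree G r par depth u v k l"
    using uv kl by unfold_locales
  moreover have "(u, v) \<in> parcs G ^^ (k + l)"
    using relpow_funpow_par[OF uv(1) kl(1)] kl(3)
      symD[OF sym_relpow[OF sym_parcs] relpow_funpow_par[OF uv(2) kl(2)]]
    by (auto simp: relpow_add)
  ultimately show thesis using that by (blast intro: hop_dist_le)
qed

section \<open>Levers\<close>

definition lever_par :: "nat \<Rightarrow> nat \<Rightarrow> nat \<Rightarrow> nat" where
  "lever_par d k j = (if j < k then j + 1 else if j \<le> d then j - 1 else k)"

definition lever_depth :: "nat \<Rightarrow> nat \<Rightarrow> nat \<Rightarrow> nat" where
  "lever_depth d k j = (if j < k then k - j else if j \<le> d then j - k else 1)"

lemma pverts_lever: "pverts (lever n d k) = {..<n}"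
  by (simp add: lever_def Let_def)

lemma parcs_lever:
  "(x, y) \<in> parcs (lever n d k) \<longleftrightarrow>
    y = x + 1 \<and> x < d \<or> x = y + 1 \<and> y < d \<or> x = k \<and> d < y \<and> y < n \<or> y = k \<and> d < x \<and> x < n"
  by (auto simp: lever_def Let_def)

lemma rooted_tree_lever:
  assumes "k \<le> d" "d < n"
  shows "rooted_tree (lever n d k) k (lever_par d k) (lever_depth d k)"
proof
  show "parcs (lever n d k) = {(w, lever_par d k w) | w. w \<in> pverts (lever n d k) - {k}}
      \<union> {(lever_par d k w, w) | w. w \<in> pverts (lever n d k) - {k}}" (is "_ = ?A \<union> ?B")
  proof (rule antisym; rule subrelI)
    fix x y assume "(x, y) \<in> parcs (lever n d k)"
    then consider "y = lever_par d k x" "x < n" "x \<noteq> k" | "x = lever_par d k y" "y < n" "y \<noteq> k"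
      using assms
      by (atomize_elim, cases "x < k"; cases "y < k") (auto simp: parcs_lever lever_par_def)
    then show "(x, y) \<in> ?A \<union> ?B" by cases (auto simp: pverts_lever)
  next
    fix x y assume "(x, y) \<in> ?A \<union> ?B"
    then show "(x, y) \<in> parcs (lever n d k)"
      using assms by (auto simp: parcs_lever pverts_lever lever_par_def split: if_splits)
  qed
qed (use assms in \<open>auto simp: pverts_lever lever_par_def lever_depth_def\<close>)

definition lever_subtree_size :: "nat \<Rightarrow> nat \<Rightarrow> nat \<Rightarrow> nat" where
  "lever_subtree_size d k j = (if j < k then Suc j else if j \<le> d then Suc (d - j) else 1)"

lemma subtree_size_lever:
  assumes kd: "k \<le> d" "d < n" and w: "w < n" "w \<noteq> k"
  shows "rooted_tree.subtree_size (lever n d k) (lever_par d k) (lever_depth d k) w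
    = lever_subtree_size d k w"
proof -
  interpret rooted_tree "lever n d k" k "lever_par d k" "lever_depth d k"
    by (rule rooted_tree_lever) fact+
  have "lever_subtree_size d k w = of_nat (subtree_size w)"
  proof (rule subtree_size_unique)
    show "w \<in> pverts (lever n d k) - {k}" using w by (simp add: pverts_lever)
    fix x assume "x \<in> pverts (lever n d k) - {k}"
    then have "x < n" "x \<noteq> k" by (auto simp: pverts_lever)
    then have "children x = (if x < k then {j. Suc j = x} else if x < d then {Suc x} else {})"
      using kd by (auto simp: children_def pverts_lever lever_par_def split: if_splits)
    moreover have "{j. Suc j = x} = (case x of 0 \<Rightarrow> {} | Suc i \<Rightarrow> {i})"
      by (auto split: nat.split)
    ultimately show "lever_subtree_size d k x = 1 + (\<Sum>c\<in>children x. lever_subtree_size d k c)"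
      using kd \<open>x \<noteq> k\<close> by (auto simp: lever_subtree_size_def split: nat.split)
  qed
  then show ?thesis by simp
qed

lemma subtree_pairs_lever:
  assumes "k \<le> d" "d < n"
  shows "rooted_tree.subtree_pairs (lever n d k) k (lever_par d k) (lever_depth d k)
    = fork_pairs k (d - k)"
proof -
  interpret rooted_tree "lever n d k" k "lever_par d k" "lever_depth d k"
    by (rule rooted_tree_lever) fact+
  let ?s = "\<lambda>j. lever_subtree_size d k j choose 2"
  have "subtree_pairs = (\<Sum>j\<in>{..<n} - {k}. ?s j)"
    unfolding subtree_pairs_def pverts_lever
    using assms by (intro sum.cong) (simp_all add: subtree_size_lever)
  also have "{..<n} - {k} = {..<k} \<union> ({Suc k..d} \<union> {Suc d..<n})" using assms by auto
  also have "(\<Sum>j\<in>\<dots>. ?s j) = (\<Sum>j<k. ?s j) + ((\<Sum>j\<in>{Suc k..d}. ?s j) + (\<Sum>j\<in>{Suc d..<n}. ?s j))"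
    using assms by (subst sum.union_disjoint; (subst sum.union_disjoint)?) auto
  also have "(\<Sum>j<k. ?s j) = Suc k choose 3"
    by (simp add: lever_subtree_size_def flip: sum_Suc_choose_two)
  also have "(\<Sum>j\<in>{Suc k..d}. ?s j) = Suc (d - k) choose 3"
    unfolding sum_Suc_choose_two[symmetric]
    by (rule sum.reindex_bij_witness[of _ "\<lambda>i. d - i" "\<lambda>j. d - j"]) (auto simp: lever_subtree_size_def)
  also have "(\<Sum>j\<in>{Suc d..<n}. ?s j) = 0"
    using assms by (intro sum.neutral) (auto simp: lever_subtree_size_def)
  finally show ?thesis by (simp add: fork_pairs_def)
qed

definition lever_meeting_time :: "nat \<Rightarrow> nat \<Rightarrow> nat \<Rightarrow> real" where
  "lever_meeting_time n d k = 1 / 2 + 4 * real (fork_pairs k (d - k)) / (real n - 1)"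

lemma meeting_time_lever:
  assumes "0 < d" and kd: "k \<le> d" "d < n"
  shows "meeting_time (lever n d k) k = ennreal (lever_meeting_time n d k)"
  using rooted_tree.meeting_time_root[OF rooted_tree_lever[OF kd]] assms
  by (simp add: pverts_lever subtree_pairs_lever lever_meeting_time_def)

lemma lever_meeting_time_balanced:
  assumes "d < n"
  shows "lever_meeting_time n d (d div 2) =
    (if odd d then (real d ^ 3 - real d) / (6 * (real n - 1)) + 1 / 2
     else (real d ^ 3 - 4 * real d) / (6 * (real n - 1)) + 1 / 2)"
proof -
  define m where "m = d div 2"
  have "24 * real (fork_pairs m (d - m))
      = (if odd d then real d ^ 3 - real d else real d ^ 3 - 4 * real d)"
  proof (cases "odd d")
    case True
    then have "d - m = Suc m" "real d = 2 * real m + 1" unfolding m_def by (auto elim: oddE)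
    then show ?thesis
      using True by (simp add: fork_pairs_def real_choose_three power3_eq_cube field_simps)
  next
    case False
    then have "d - m = m" "real d = 2 * real m" unfolding m_def by auto
    then show ?thesis
      using False by (simp add: fork_pairs_def real_choose_three power3_eq_cube field_simps)
  qed
  moreover have "lever_meeting_time n d m
      = 24 * real (fork_pairs m (d - m)) / (6 * (real n - 1)) + 1 / 2"
    using mult_divide_mult_cancel_left[of "6 :: real" "4 * real (fork_pairs m (d - m))" "real n - 1"]
    by (simp add: lever_meeting_time_def)
  ultimately show ?thesis by (simp add: m_def)
qed

lemma relpow_lever_path:
  assumes "x \<le> y" and "y \<le> d"
  shows "(x, y) \<in> parcs (lever n d k) ^^ (y - x)"
  unfolding relpow_fun_conv using assms by (intro exI[of _ "\<lambda>i. x + i"]) (auto simp: parcs_lever)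

lemma relpow_Lipschitz:
  fixes \<phi> :: "'a \<Rightarrow> int"
  assumes "\<And>x y. (x, y) \<in> R \<Longrightarrow> \<phi> y \<le> \<phi> x + 1" and "(x, y) \<in> R ^^ k"
  shows "\<phi> y \<le> \<phi> x + int k"
  using assms(2)
proof (induction k arbitrary: y)
  case (Suc k)
  then obtain z where "(x, z) \<in> R ^^ k" "(z, y) \<in> R" by auto
  then show ?case using Suc.IH[of z] assms(1)[of z y] by simp
qed auto

lemma hop_dist_lever_ends:
  assumes "k < d"
  shows "hop_dist (parcs (lever n d k)) 0 d = d"
proof (rule antisym)
  have path: "(0, d) \<in> parcs (lever n d k) ^^ d"
    using relpow_lever_path[of 0 d d] by simp
  then show "hop_dist (parcs (lever n d k)) 0 d \<le> d" by (rule hop_dist_le)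
  define \<phi> where "\<phi> j = (if j \<le> d then int j else int k + 1)" for j
  have "\<phi> y \<le> \<phi> x + 1" if "(x, y) \<in> parcs (lever n d k)" for x y
    using that assms by (auto simp: parcs_lever \<phi>_def)
  then have "\<phi> d \<le> \<phi> 0 + int (hop_dist (parcs (lever n d k)) 0 d)"
    using relpow_Lipschitz[of _ \<phi>] relpow_hop_dist relpow_imp_rtrancl[OF path] by metis
  then show "d \<le> hop_dist (parcs (lever n d k)) 0 d" by (simp add: \<phi>_def)
qed

lemma graph_diameter_lever:
  assumes "0 < k" "k < d" "d < n"
  shows "graph_diameter (lever n d k) = ereal (real d)"
proof -
  interpret rooted_tree "lever n d k" k "lever_par d k" "lever_depth d k"
    using assms by (intro rooted_tree_lever) auto
  let ?E = "parcs (lever n d k)"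
  have "hop_dist ?E x y \<le> d" if "x < n" "y < n" for x y
  proof -
    consider "x \<le> y" "y \<le> d" | "y \<le> x" "x \<le> d" | "d < x \<or> d < y" by linarith
    then show ?thesis
    proof cases
      case 1
      then have "hop_dist ?E x y \<le> y - x" by (intro hop_dist_le relpow_lever_path)
      then show ?thesis using 1 by simp
    next
      case 2
      then have "hop_dist ?E x y \<le> x - y"
        using symD[OF sym_relpow[OF sym_parcs] relpow_lever_path] by (intro hop_dist_le)
      then show ?thesis using 2 by simp
    next
      case 3
      then have "lever_depth d k x + lever_depth d k y \<le> d"
        using assms by (auto simp: lever_depth_def)
      moreover have "hop_dist ?E x y \<le> lever_depth d k x + lever_depth d k y"
        using that by (intro hop_dist_le relpow_depths) (simp_all add: pverts_lever)
      ultimately show ?thesis by simp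
    qed
  qed
  moreover have "hop_dist ?E 0 d = d" using assms by (intro hop_dist_lever_ends)
  ultimately show ?thesis
    unfolding undirected_tree_graph_diameter_eq_iff[OF undirected_tree] pverts_lever
    using assms by auto
qed

section \<open>Forked trees that are levers\<close>

lemma rooted_tree_iso:
  assumes G: "rooted_tree G r par depth" and H: "rooted_tree H (f r) par' depth'"
    and inj: "inj_on f (pverts G)" and verts: "pverts H = f ` pverts G"
    and par': "\<And>w. w \<in> pverts G - {r} \<Longrightarrow> par' (f w) = f (par w)"
  shows "pair_graph_iso G H f"
proof -
  interpret G: rooted_tree G r par depth by fact
  interpret H: rooted_tree H "f r" par' depth' by fact
  let ?S = "pverts G - {r}"
  have "pverts H - {f r} = f ` ?S"
    using inj_on_image_set_diff[OF inj, of "pverts G" "{r}"] verts G.root_in by simp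
  moreover have "parcs H = (\<lambda>w. (w, par' w)) ` (pverts H - {f r})
      \<union> (\<lambda>w. (par' w, w)) ` (pverts H - {f r})"
    unfolding H.arcs_eq by blast
  ultimately have "parcs H = (\<lambda>w. (f w, f (par w))) ` ?S \<union> (\<lambda>w. (f (par w), f w)) ` ?S"
    using par' by (simp add: image_image cong: image_cong_simp)
  moreover have "parcs G = (\<lambda>w. (w, par w)) ` ?S \<union> (\<lambda>w. (par w, w)) ` ?S"
    unfolding G.arcs_eq by blast
  ultimately have "parcs H = map_prod f f ` parcs G"
    by (simp add: image_Un image_image)
  then show ?thesis
    using G.pair_graph inj verts by (simp add: pair_graph_iso_def pair_graph_iso_axioms_def)
qed

locale lever_shaped_tree = forked_tree +
  assumes apex: "(par ^^ k) u = r"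
    and par_off_trails: "w \<in> off_trails \<Longrightarrow> par w = r"
begin

definition lever_vertex :: "(nat \<Rightarrow> 'a) \<Rightarrow> nat \<Rightarrow> 'a" where
  "lever_vertex e i =
     (if i \<le> k then (par ^^ i) u else if i \<le> k + l then (par ^^ (k + l - i)) v else e i)"

lemma lever_vertex_right: "k \<le> i \<Longrightarrow> i \<le> k + l \<Longrightarrow> lever_vertex e i = (par ^^ (k + l - i)) v"
  using meet by (auto simp: lever_vertex_def)

lemma lever_vertex_fulcrum: "lever_vertex e k = r"
  using apex by (simp add: lever_vertex_def)

lemma card_verts: "card (pverts G) = Suc (k + l) + card off_trails"
proof -
  have "pverts G = insert r (trail u k \<union> trail v l \<union> off_trails)"
    using root_in trail_subset[OF u_in k_le] trail_subset[OF v_in l_le] by (auto simp: off_trails_def)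
  moreover have "r \<notin> trail u k \<union> trail v l \<union> off_trails"
    using trail_subset[OF u_in k_le] trail_subset[OF v_in l_le] by (auto simp: off_trails_def)
  moreover have "(trail u k \<union> trail v l) \<inter> off_trails = {}" by (auto simp: off_trails_def)
  ultimately show ?thesis
    using disjoint card_trail[OF u_in le_SucI[OF k_le]] card_trail[OF v_in le_SucI[OF l_le]]
    by (simp add: card_Un_disjoint finite_trail finite_off_trails)
qed

lemma lever_vertex_image:
  assumes e: "e ` {Suc (k + l)..<card (pverts G)} = off_trails"
  shows "lever_vertex e ` {..<card (pverts G)} = pverts G"
proof -
  have "{..<card (pverts G)} = {..<k} \<union> {k} \<union> {k<..k + l} \<union> {Suc (k + l)..<card (pverts G)}"
    using card_verts by auto
  moreover have "lever_vertex e ` {..<k} = trail u k"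
    by (auto simp: lever_vertex_def trail_def)
  moreover have "lever_vertex e ` {k<..k + l} = trail v l"
  proof -
    have "lever_vertex e ` {k<..k + l} = (\<lambda>i. (par ^^ i) v) ` (\<lambda>i. k + l - i) ` {k<..k + l}"
      by (simp add: image_image lever_vertex_right)
    also have "(\<lambda>i. k + l - i) ` {k<..k + l} = {..<l}"
    proof (rule antisym; rule subsetI)
      fix i assume "i \<in> {..<l}"
      then show "i \<in> (\<lambda>i. k + l - i) ` {k<..k + l}"
        by (intro image_eqI[of _ _ "k + l - i"]) auto
    qed auto
    finally show ?thesis by (simp add: trail_def)
  qed
  moreover have "lever_vertex e ` {Suc (k + l)..<card (pverts G)} = off_trails"
    using e by (simp add: lever_vertex_def)
  ultimately show ?thesis
    using root_in trail_subset[OF u_in k_le] trail_subset[OF v_in l_le]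
    by (auto simp: image_Un lever_vertex_fulcrum off_trails_def)
qed

lemma par_lever_vertex:
  assumes e: "e ` {Suc (k + l)..<card (pverts G)} = off_trails"
    and j: "j < card (pverts G)" "j \<noteq> k"
  shows "par (lever_vertex e j) = lever_vertex e (lever_par (k + l) k j)"
proof -
  consider "j < k" | "k < j" "j \<le> k + l" | "k + l < j" using j by linarith
  then show ?thesis
  proof cases
    case 1
    then show ?thesis by (simp add: lever_vertex_def lever_par_def)
  next
    case 2
    then have "k + l - (j - 1) = Suc (k + l - j)" by simp
    then show ?thesis
      using 2 lever_vertex_right[of j] lever_vertex_right[of "j - 1"] by (simp add: lever_par_def)
  next
    case 3
    then have "e j \<in> off_trails" using e j by auto
    then show ?thesis
      using 3 par_off_trails
      by (simp add: lever_vertex_fulcrum lever_par_def) (simp add: lever_vertex_def)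
  qed
qed

theorem digraph_iso_lever: "digraph_iso (with_proj G) (with_proj (lever (card (pverts G)) (k + l) k))"
proof -
  let ?n = "card (pverts G)"
  interpret lever: rooted_tree "lever ?n (k + l) k" k "lever_par (k + l) k" "lever_depth (k + l) k"
    using card_verts by (intro rooted_tree_lever) auto
  have "card {Suc (k + l)..<?n} = card off_trails" using card_verts by simp
  then obtain e where "bij_betw e {Suc (k + l)..<?n} off_trails"
    using finite_same_card_bij finite_off_trails by blast
  then have e: "e ` {Suc (k + l)..<?n} = off_trails" by (rule bij_betw_imp_surj_on)
  note image = lever_vertex_image[OF e]
  have "pair_graph_iso (lever ?n (k + l) k) G (lever_vertex e)"
  proof (rule rooted_tree_iso[OF lever.rooted_tree_axioms])
    show "rooted_tree G (lever_vertex e k) par depth"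
      unfolding lever_vertex_fulcrum by unfold_locales
    show "inj_on (lever_vertex e) (pverts (lever ?n (k + l) k))"
      unfolding pverts_lever by (rule eq_card_imp_inj_on) (simp_all add: image)
    show "par (lever_vertex e j) = lever_vertex e (lever_par (k + l) k j)"
      if "j \<in> pverts (lever ?n (k + l) k) - {k}" for j
      using that by (intro par_lever_vertex[OF e]) (auto simp: pverts_lever)
  qed (simp add: pverts_lever image)
  moreover have "wf_digraph (with_proj (lever ?n (k + l) k))"
    using lever.graph.pair_wf_digraph by (simp add: wf_digraph_wp_iff)
  ultimately show ?thesis
    by (blast intro: digraph_iso_swap pair_graph_iso.digraph_iso)
qed

end

lemma (in forked_tree) tight_imp_digraph_iso_lever:
  assumes "subtree_pairs = fork_pairs k l" and "0 < k"
  shows "digraph_iso (with_proj G) (with_proj (lever (card (pverts G)) (k + l) k))"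
proof -
  interpret lever_shaped_tree G r par depth u v k l
    using tight_apex[OF assms] tight_par_off_trails[OF assms(1)] by unfold_locales
  show ?thesis by (rule digraph_iso_lever)
qed

section \<open>Balanced levers minimize the best meeting time\<close>

lemma (in rooted_tree)
  assumes "u \<in> pverts G" "v \<in> pverts G" "hop_dist (parcs G) u v = d"
  shows balanced_fork_pairs_le_subtree_pairs:
      "fork_pairs (d div 2) (d - d div 2) \<le> subtree_pairs"
    and subtree_pairs_eq_imp_balanced_lever:
      "2 \<le> d \<Longrightarrow> subtree_pairs = fork_pairs (d div 2) (d - d div 2) \<Longrightarrow>
      digraph_iso (with_proj G) (with_proj (balanced_lever (card (pverts G)) d))"
proof -
  obtain k l where fork: "forked_tree G r par depth u v k l" and kl: "d \<le> k + l"
    using distance_imp_forked_tree[OF assms(1,2)] assms(3) by blast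
  note bounds = fork_pairs_balanced_le[OF kl] forked_tree.fork_pairs_le_subtree_pairs[OF fork]
  then show "fork_pairs (d div 2) (d - d div 2) \<le> subtree_pairs" by simp
  assume "2 \<le> d" and eq: "subtree_pairs = fork_pairs (d div 2) (d - d div 2)"
  then have tight: "subtree_pairs = fork_pairs k l" and "0 < d div 2" using bounds by simp_all
  have "\<exists>u v. forked_tree G r par depth u v (d div 2) (d - d div 2)"
    using fork_pairs_eq_balanced[OF kl \<open>2 \<le> d\<close>] tight eq fork forked_tree.swap[OF fork] by metis
  then show "digraph_iso (with_proj G) (with_proj (balanced_lever (card (pverts G)) d))"
    using forked_tree.tight_imp_digraph_iso_lever[OF _ eq \<open>0 < d div 2\<close>]
    by (auto simp: balanced_lever_def)
qed

lemma undirected_tree_best_meeting_time: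
  assumes G: "undirected_tree G" and n: "2 \<le> card (pverts G)"
  obtains r par depth where "rooted_tree G r par depth"
    "best_meeting_time G = ennreal
      (1 / 2 + 4 * real (rooted_tree.subtree_pairs G r par depth) / (real (card (pverts G)) - 1))"
proof -
  have "finite (pverts G)" "pverts G \<noteq> {}" using n card_ge_0_finite[of "pverts G"] by auto
  then have "best_meeting_time G \<in> meeting_time G ` pverts G"
    unfolding best_meeting_time_def by (intro Min_in) auto
  then obtain r where r: "r \<in> pverts G" "best_meeting_time G = meeting_time G r" by blast
  obtain par depth where "rooted_tree G r par depth"
    using undirected_tree_imp_rooted_tree[OF G r(1)] .
  then show thesis
    using rooted_tree.meeting_time_root[OF _ n] r(2) by (intro that) simp_all
qed

lemma
  assumes G: "undirected_tree G" "card (pverts G) = n" "graph_diameter G = ereal (real d)"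
    and d: "2 \<le> d" "d < n"
  shows lever_meeting_time_le_best_meeting_time:
      "ennreal (lever_meeting_time n d (d div 2)) \<le> best_meeting_time G"
    and best_meeting_time_eq_imp_balanced_lever:
      "best_meeting_time G = ennreal (lever_meeting_time n d (d div 2)) \<Longrightarrow>
      digraph_iso (with_proj G) (with_proj (balanced_lever n d))"
proof -
  obtain r par depth where tree: "rooted_tree G r par depth"
    and best: "best_meeting_time G
      = ennreal (1 / 2 + 4 * real (rooted_tree.subtree_pairs G r par depth) / (real n - 1))"
    using undirected_tree_best_meeting_time[OF G(1)] G(2) d by auto
  interpret rooted_tree G r par depth by (rule tree)
  obtain u v where "u \<in> pverts G" "v \<in> pverts G" "hop_dist (parcs G) u v = d"
    using undirected_tree_graph_diameter_eq_iff[OF G(1)] G(3) by blast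
  note bound = balanced_fork_pairs_le_subtree_pairs[OF this]
    and equality = subtree_pairs_eq_imp_balanced_lever[OF this d(1)]
  have N: "0 < real n - 1" using d by simp
  show "ennreal (lever_meeting_time n d (d div 2)) \<le> best_meeting_time G"
    unfolding best lever_meeting_time_def using bound N
    by (intro ennreal_leI add_left_mono divide_right_mono) auto
  assume "best_meeting_time G = ennreal (lever_meeting_time n d (d div 2))"
  then have "subtree_pairs = fork_pairs (d div 2) (d - d div 2)"
    unfolding best lever_meeting_time_def using N by (simp add: add_nonneg_nonneg del: ennreal_plus)
  then show "digraph_iso (with_proj G) (with_proj (balanced_lever n d))"
    using equality G(2) by simp
qed

lemma undirected_tree_balanced_lever:
  assumes "d < n"
  shows "undirected_tree (balanced_lever n d)"
  unfolding balanced_lever_def using assms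
  by (intro rooted_tree.undirected_tree[OF rooted_tree_lever]) auto

lemma graph_diameter_balanced_lever:
  "2 \<le> d \<Longrightarrow> d < n \<Longrightarrow> graph_diameter (balanced_lever n d) = ereal (real d)"
  unfolding balanced_lever_def by (intro graph_diameter_lever) auto

lemma card_pverts_balanced_lever: "card (pverts (balanced_lever n d)) = n"
  by (simp add: balanced_lever_def pverts_lever)

lemma best_meeting_time_balanced_lever:
  assumes d: "2 \<le> d" "d < n"
  shows "best_meeting_time (balanced_lever n d) = ennreal (lever_meeting_time n d (d div 2))"
proof (rule antisym)
  have "best_meeting_time (balanced_lever n d) \<le> meeting_time (balanced_lever n d) (d div 2)"
    unfolding best_meeting_time_def balanced_lever_def
    using d by (intro Min_le) (auto simp: pverts_lever)
  also have "\<dots> = ennreal (lever_meeting_time n d (d div 2))"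
    unfolding balanced_lever_def using d by (intro meeting_time_lever) auto
  finally show "best_meeting_time (balanced_lever n d) \<le> ennreal (lever_meeting_time n d (d div 2))" .
  show "ennreal (lever_meeting_time n d (d div 2)) \<le> best_meeting_time (balanced_lever n d)"
    using d by (intro lever_meeting_time_le_best_meeting_time undirected_tree_balanced_lever
        card_pverts_balanced_lever graph_diameter_balanced_lever)
qed

theorem theorem1p6:
  fixes n d :: nat
  assumes "2 \<le> d" and "d \<le> n - 1"
  shows
    "undirected_tree (balanced_lever n d) \<and> card (pverts (balanced_lever n d)) = n \<and>
       graph_diameter (balanced_lever n d) = ereal (real d) \<and>
     (\<forall>G :: 'a pair_pre_digraph.
        undirected_tree G \<and> card (pverts G) = n \<and> graph_diameter G = ereal (real d) \<longrightarrow>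
          best_meeting_time (balanced_lever n d) \<le> best_meeting_time G \<and>
          (best_meeting_time G = best_meeting_time (balanced_lever n d) \<longleftrightarrow>
             digraph_iso (with_proj G) (with_proj (balanced_lever n d)))) \<and>
     best_meeting_time (balanced_lever n d) =
       ennreal (if odd d then (real d ^ 3 - real d) / (6 * (real n - 1)) + 1 / 2
                else (real d ^ 3 - 4 * real d) / (6 * (real n - 1)) + 1 / 2)"
proof -
  have "d < n" using assms by simp
  note best = best_meeting_time_balanced_lever[OF assms(1) \<open>d < n\<close>]
  have minimal: "best_meeting_time (balanced_lever n d) \<le> best_meeting_time G"
    and unique: "best_meeting_time G = best_meeting_time (balanced_lever n d) \<longleftrightarrow>
      digraph_iso (with_proj G) (with_proj (balanced_lever n d))"
    if "undirected_tree G" "card (pverts G) = n" "graph_diameter G = ereal (real d)"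
    for G :: "'a pair_pre_digraph"
    using lever_meeting_time_le_best_meeting_time[OF that assms(1) \<open>d < n\<close>]
      best_meeting_time_eq_imp_balanced_lever[OF that assms(1) \<open>d < n\<close>]
      best_meeting_time_iso[of G "balanced_lever n d"] that(1)
    unfolding best undirected_tree_def by auto
  show ?thesis
    using minimal unique undirected_tree_balanced_lever[OF \<open>d < n\<close>] card_pverts_balanced_lever
      graph_diameter_balanced_lever[OF assms(1) \<open>d < n\<close>] lever_meeting_time_balanced[OF \<open>d < n\<close>] best
    by simp
qed

end
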